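(* Let $K$ be an arbitrary compact metric space. Then there exists a closed subset $C\subseteq\mathbb{U}\times K$ that is universal and ultrahomogeneous. Precisely, $(\mathbb{U},C)$ is uniquely characterized by the following property. (Ultrahomogeneity) Let $A_1,A_2\subseteq\mathbb{U}$ be two finite subsets of $\mathbb{U}$ and $K_0\subseteq K$ a finite subset of $K$ such that there is an isometry $\iota:A_1\to A_2$ and for any $x\in A_1$ and $k\in K_0$ we have $\mathrm{dist}((x,k),C)=\mathrm{dist}((\iota(x),k),C)$. Then $\iota$ extends to an autoisometry $\bar\iota$ of $\mathbb{U}$ such that for any $x\in\mathbb{U}$ and $k\in K$ we have $\mathrm{dist}((x,k),C)=\mathrm{dist}((\bar\iota(x),k),C)$. As a consequence, $(\mathbb{U},C)$ has the following property. (Universality) For any Polish metric space $X$ equipped with a closed subset $E\subseteq X\times K$ there is an isometric embedding $\iota:X\hookrightarrow\mathbb{U}$ such that for any $x\in X$ and $k\in K$ we have $\mathrm{dist}((x,k),E)=\mathrm{dist}((\iota(x),k),C)$.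
   Context: A Polish metric space is a separable complete metric space. $\mathbb{U}$ denotes the Urysohn universal metric space: the (unique up to isometry) separable complete metric space such that for every finite (possibly empty) subset $M\subseteq\mathbb{U}$ and every finite metric space $M'\supseteq M$ extending $M$, the inclusion $M\hookrightarrow\mathbb{U}$ extends to an isometric embedding $M'\hookrightarrow\mathbb{U}$. Products of metric spaces carry the sum metric, $d((x,k),(x',k'))=d(x,x')+d_K(k,k')$, and $\mathrm{dist}(z,C)=\inf_{c\in C}d(z,c)$. An autoisometry of $\mathbb{U}$ is a surjective isometry $\mathbb{U}\to\mathbb{U}$.
   Formalization: As printed, agreement over finite K_0 giving agreement over K contradicts universality; here both use the same K_0 (finite or all of K). Uniqueness is among closed sets also assumed universal (U×K is ultrahomogeneous). X is carried by a set of reals; dist to the empty set is 0. *)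

theory Defs
  imports "HOL-Analysis.Analysis"
begin

section \<open>Metric spaces\<close>

text \<open>
  All spaces are values of the library type of abstract metric spaces, so that they can be
  quantified over inside a formula, and may be empty.
\<close>

definition polish_metric :: "'a metric \<Rightarrow> bool" where
  "polish_metric m \<longleftrightarrow> mcomplete_of m \<and> separable_space (mtopology_of m)"

text \<open>The library's \<^const>\<open>prod_metric\<close> is the Euclidean (square root) product, not the sum.\<close>

definition sum_metric :: "'a metric \<Rightarrow> 'b metric \<Rightarrow> ('a \<times> 'b) metric" where
  "sum_metric m m' =
     metric (mspace m \<times> mspace m', \<lambda>(x, k) (x', k'). mdist m x x' + mdist m' k k')"

text \<open>
  Point-to-set distance, the analogue of \<^const>\<open>infdist\<close> for abstract metrics.  As there, the
  distance to the empty set is 0 by convention.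
\<close>

definition minfdist :: "'a metric \<Rightarrow> 'a \<Rightarrow> 'a set \<Rightarrow> real" where
  "minfdist m z C = (if C = {} then 0 else INF c\<in>C. mdist m z c)"

definition isometric_embedding :: "'a metric \<Rightarrow> 'b metric \<Rightarrow> ('a \<Rightarrow> 'b) \<Rightarrow> bool" where
  "isometric_embedding m m' f \<longleftrightarrow>
     f \<in> mspace m \<rightarrow> mspace m' \<and>
     (\<forall>x\<in>mspace m. \<forall>y\<in>mspace m. mdist m' (f x) (f y) = mdist m x y)"

definition isometry_onto :: "'a metric \<Rightarrow> 'a set \<Rightarrow> 'a set \<Rightarrow> ('a \<Rightarrow> 'a) \<Rightarrow> bool" where
  "isometry_onto m A B f \<longleftrightarrow>
     f ` A = B \<and> (\<forall>x\<in>A. \<forall>y\<in>A. mdist m (f x) (f y) = mdist m x y)"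

abbreviation autoisometry :: "'a metric \<Rightarrow> ('a \<Rightarrow> 'a) \<Rightarrow> bool" where
  "autoisometry m \<equiv> isometry_onto m (mspace m) (mspace m)"

section \<open>The Urysohn space\<close>

text \<open>
  A finite metric space extending \<open>M\<close> needs room for new points outside the carrier type of
  \<open>U\<close>; otherwise a one-point type would satisfy the extension property trivially.  So \<open>M'\<close> lives
  on the disjoint sum with \<^typ>\<open>nat\<close>, and \<open>M\<close> is identified with \<open>Inl ` M\<close>.
\<close>

definition urysohn_space :: "'u metric \<Rightarrow> bool" where
  "urysohn_space U \<longleftrightarrow>
     polish_metric U \<and>
     (\<forall>M (M' :: ('u + nat) metric).
        finite M \<and> M \<subseteq> mspace U \<and> finite (mspace M') \<and> Inl ` M \<subseteq> mspace M' \<and>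
        (\<forall>x\<in>M. \<forall>y\<in>M. mdist M' (Inl x) (Inl y) = mdist U x y) \<longrightarrow>
        (\<exists>f. isometric_embedding M' U f \<and> (\<forall>x\<in>M. f (Inl x) = x)))"

section \<open>Closed relations between the Urysohn space and a compact space\<close>

text \<open>
  In the usual informal formulation of ultrahomogeneity one takes a finite \<open>K\<^sub>0 \<subseteq> K\<close>, assumes
  that \<open>\<iota>\<close> preserves the distances to \<open>C\<close> over \<open>K\<^sub>0\<close>, and asks for an extension that
  preserves them over all of \<open>K\<close>.  That cannot be meant literally: agreement over \<open>K\<^sub>0\<close>
  does not imply agreement over \<open>K\<close> already for the points of the domain of \<open>\<iota>\<close>, see
  \<open>finite_agreement_insufficient\<close> below.  Hence hypothesis and conclusion refer here to the same set
  \<open>K\<^sub>0\<close>, which is either finite or all of \<open>K\<close>; in the latter case \<open>\<phi>\<close> preserves all distances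
  to \<open>C\<close>.
\<close>

definition ultrahomogeneous :: "'u metric \<Rightarrow> 'k metric \<Rightarrow> ('u \<times> 'k) set \<Rightarrow> bool" where
  "ultrahomogeneous U K C \<longleftrightarrow>
     (\<forall>A\<^sub>1 A\<^sub>2 K\<^sub>0 \<iota>.
        finite A\<^sub>1 \<and> A\<^sub>1 \<subseteq> mspace U \<and> finite A\<^sub>2 \<and> A\<^sub>2 \<subseteq> mspace U \<and>
        K\<^sub>0 \<subseteq> mspace K \<and> (finite K\<^sub>0 \<or> K\<^sub>0 = mspace K) \<and>
        isometry_onto U A\<^sub>1 A\<^sub>2 \<iota> \<and>
        (\<forall>x\<in>A\<^sub>1. \<forall>k\<in>K\<^sub>0.
           minfdist (sum_metric U K) (x, k) C = minfdist (sum_metric U K) (\<iota> x, k) C) \<longrightarrow>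
        (\<exists>\<phi>. autoisometry U \<phi> \<and> (\<forall>x\<in>A\<^sub>1. \<phi> x = \<iota> x) \<and>
           (\<forall>x\<in>mspace U. \<forall>k\<in>K\<^sub>0.
              minfdist (sum_metric U K) (x, k) C = minfdist (sum_metric U K) (\<phi> x, k) C)))"

text \<open>
  A Polish space has at most continuum many points, so every Polish metric space is isometric to
  one whose carrier is a set of reals.  The lemma \<open>universalD\<close> below gives the property for
  Polish metric spaces over an arbitrary type.
\<close>

definition universal :: "'u metric \<Rightarrow> 'k metric \<Rightarrow> ('u \<times> 'k) set \<Rightarrow> bool" where
  "universal U K C \<longleftrightarrow>
     (\<forall>(X :: real metric) E.
        polish_metric X \<and> closedin (mtopology_of (sum_metric X K)) E \<longrightarrow>
        (\<exists>\<iota>. isometric_embedding X U \<iota> \<and>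
           (\<forall>x\<in>mspace X. \<forall>k\<in>mspace K.
              minfdist (sum_metric X K) (x, k) E = minfdist (sum_metric U K) (\<iota> x, k) C)))"

section \<open>Basic facts\<close>

lemma Metric_space_sum:
  "Metric_space (mspace m \<times> mspace m') (\<lambda>(x, k) (x', k'). mdist m x x' + mdist m' k k')"
proof
  fix p q r
  show "0 \<le> (case p of (x, k) \<Rightarrow> \<lambda>(x', k'). mdist m x x' + mdist m' k k') q"
    by (auto split: prod.splits)
  show "(case p of (x, k) \<Rightarrow> \<lambda>(x', k'). mdist m x x' + mdist m' k k') q =
        (case q of (x, k) \<Rightarrow> \<lambda>(x', k'). mdist m x x' + mdist m' k k') p"
    by (auto split: prod.splits simp: mdist_commute)
  assume p: "p \<in> mspace m \<times> mspace m'" and q: "q \<in> mspace m \<times> mspace m'"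
  show "((case p of (x, k) \<Rightarrow> \<lambda>(x', k'). mdist m x x' + mdist m' k k') q = 0) = (p = q)"
    using p q by (auto simp: add_nonneg_eq_0_iff mdist_zero)
  assume r: "r \<in> mspace m \<times> mspace m'"
  show "(case p of (x, k) \<Rightarrow> \<lambda>(x', k'). mdist m x x' + mdist m' k k') r
      \<le> (case p of (x, k) \<Rightarrow> \<lambda>(x', k'). mdist m x x' + mdist m' k k') q +
        (case q of (x, k) \<Rightarrow> \<lambda>(x', k'). mdist m x x' + mdist m' k k') r"
  proof -
    obtain x k x' k' x'' k'' where "p = (x, k)" "q = (x', k')" "r = (x'', k'')"
      by (metis prod.exhaust)
    then show ?thesis
      using p q r mdist_triangle[of x m x' x''] mdist_triangle[of k m' k' k''] by auto
  qed
qed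

lemma mspace_sum_metric [simp]: "mspace (sum_metric m m') = mspace m \<times> mspace m'"
  unfolding sum_metric_def by (rule Metric_space.mspace_metric[OF Metric_space_sum])

lemma mdist_sum_metric [simp]:
  "mdist (sum_metric m m') (x, k) (x', k') = mdist m x x' + mdist m' k k'"
  unfolding sum_metric_def by (simp add: Metric_space.mdist_metric[OF Metric_space_sum])

lemma isometry_homeomorphic:
  assumes "f ` mspace m = mspace m'"
    and "\<And>x y. x \<in> mspace m \<Longrightarrow> y \<in> mspace m \<Longrightarrow> mdist m' (f x) (f y) = mdist m x y"
  shows "homeomorphic_map (mtopology_of m) (mtopology_of m') f"
  using Metric_space12.isometry_imp_homeomorphic_map[OF Metric_space12_mspace_mdist assms]
  by (simp add: mtopology_of_def)

lemma minfdist_image: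
  assumes "\<And>c. c \<in> C \<Longrightarrow> mdist m' (f z) (f c) = mdist m z c"
  shows "minfdist m' (f z) (f ` C) = minfdist m z C"
proof -
  have "mdist m' (f z) ` f ` C = mdist m z ` C"
    using assms by (simp add: image_image)
  then show ?thesis
    by (simp add: minfdist_def)
qed

lemma minfdist_finite_eq_0_iff:
  assumes "finite C" "C \<noteq> {}" "C \<subseteq> mspace m" "z \<in> mspace m"
  shows "minfdist m z C = 0 \<longleftrightarrow> z \<in> C"
proof -
  have eq: "minfdist m z C = Min (mdist m z ` C)"
    using assms by (simp add: minfdist_def cInf_eq_Min)
  show ?thesis
  proof
    assume "minfdist m z C = 0"
    moreover have "Min (mdist m z ` C) \<in> mdist m z ` C"
      using assms by (intro Min_in) auto
    ultimately obtain c where "c \<in> C" "mdist m z c = 0"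
      unfolding eq by auto
    then show "z \<in> C"
      using assms by (auto simp: subset_eq)
  next
    assume z: "z \<in> C"
    have "Min (mdist m z ` C) \<le> mdist m z z"
      using assms z by (intro Min_le) auto
    also have "mdist m z z = 0"
      using assms by simp
    finally have "Min (mdist m z ` C) \<le> 0" .
    moreover have "0 \<le> Min (mdist m z ` C)"
      using assms by simp
    ultimately show "minfdist m z C = 0"
      unfolding eq by linarith
  qed
qed

lemma polish_metric_isometric:
  assumes X: "polish_metric X" and f: "f ` mspace X = mspace Y"
    and d: "\<And>x y. x \<in> mspace X \<Longrightarrow> y \<in> mspace X \<Longrightarrow> mdist Y (f x) (f y) = mdist X x y"
  shows "polish_metric Y"
proof -
  interpret X: Metric_space "mspace X" "mdist X" by simp
  interpret Y: Metric_space "mspace Y" "mdist Y" by simp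
  have hom: "homeomorphic_map (mtopology_of X) (mtopology_of Y) f"
    using isometry_homeomorphic[OF f d] .
  have "separable_space (mtopology_of Y)"
    using X hom homeomorphic_map_imp_homeomorphic_space homeomorphic_separable_space
    unfolding polish_metric_def by blast
  moreover have "Y.mcomplete"
    unfolding Y.mcomplete_def
  proof (intro allI impI)
    fix s assume s: "Y.MCauchy s"
    define g where "g = inv_into (mspace X) f"
    have g: "g y \<in> mspace X" "f (g y) = y" if "y \<in> mspace Y" for y
      using that f unfolding g_def by (auto intro: inv_into_into f_inv_into_f)
    have r: "s n \<in> mspace Y" for n
      using s unfolding Y.MCauchy_def by auto
    have "mdist X (g (s n)) (g (s k)) = mdist Y (s n) (s k)" for n k
      using d[of "g (s n)" "g (s k)"] g r by simp
    then have "X.MCauchy (g \<circ> s)"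
      using s g(1)[OF r] unfolding X.MCauchy_def Y.MCauchy_def by (simp add: image_subset_iff)
    then obtain l where "limitin X.mtopology (g \<circ> s) l sequentially"
      using X unfolding polish_metric_def mcomplete_of_def X.mcomplete_def by blast
    then have "limitin Y.mtopology (f \<circ> (g \<circ> s)) (f l) sequentially"
      using continuous_map_limit[OF homeomorphic_imp_continuous_map[OF hom]]
      unfolding mtopology_of_def by blast
    moreover have "f \<circ> (g \<circ> s) = s"
      using g(2)[OF r] by (simp add: fun_eq_iff)
    ultimately show "\<exists>x. limitin Y.mtopology s x sequentially" by metis
  qed
  ultimately show ?thesis
    by (simp add: polish_metric_def mcomplete_of_def)
qed

lemma separable_metric_inj_real:
  assumes "separable_space (mtopology_of X)"
  shows "\<exists>h :: 'x \<Rightarrow> real. inj_on h (mspace X)"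
proof -
  interpret X: Metric_space "mspace X" "mdist X" by simp
  obtain C where C: "countable C" "C \<subseteq> mspace X" "X.mtopology closure_of C = mspace X"
    using assms unfolding separable_space_def mtopology_of_def by auto
  define code where
    "code x = {prod_encode (n, m) |n m. mdist X (from_nat_into C n) x < inverse (real (Suc m))}"
    for x
  have "inj_on code (mspace X)"
  proof (rule inj_onI, rule ccontr)
    fix x y assume x: "x \<in> mspace X" and y: "y \<in> mspace X" and eq: "code x = code y" and "x \<noteq> y"
    then have "mdist X x y / 2 > 0" by simp
    then obtain m where m: "inverse (real (Suc m)) < mdist X x y / 2"
      using reals_Archimedean by blast
    have "x \<in> X.mtopology closure_of C" using C x by simp
    then obtain c where c: "c \<in> C" "mdist X x c < inverse (real (Suc m))"
      unfolding X.metric_closure_of using inverse_positive_iff_positive[of "real (Suc m)"]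
      by (auto simp del: inverse_positive_iff_positive)
    then obtain n where n: "c = from_nat_into C n"
      using C from_nat_into_surj by metis
    have cx: "mdist X c x < inverse (real (Suc m))" using c by (simp add: X.commute)
    then have "prod_encode (n, m) \<in> code x"
      unfolding code_def n by blast
    then have "prod_encode (n, m) \<in> code y" using eq by simp
    then have "mdist X c y < inverse (real (Suc m))"
      unfolding code_def n by auto
    moreover have "mdist X x y \<le> mdist X x c + mdist X c y"
      using x y c C by (intro mdist_triangle) auto
    ultimately show False using c m by linarith
  qed
  moreover obtain e :: "nat set \<Rightarrow> real" where "inj e"
    using nat_sets_eqpoll_reals unfolding eqpoll_def bij_betw_def by blast
  ultimately have "inj_on (e \<circ> code) (mspace X)"
    by (meson comp_inj_on inj_on_subset subset_UNIV)
  then show ?thesis by blast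
qed

lemma universalD:
  fixes X :: "'x metric"
  assumes univ: "universal U K C" and X: "polish_metric X"
    and E: "closedin (mtopology_of (sum_metric X K)) E"
  shows "\<exists>\<iota>. isometric_embedding X U \<iota> \<and>
           (\<forall>x\<in>mspace X. \<forall>k\<in>mspace K.
              minfdist (sum_metric X K) (x, k) E = minfdist (sum_metric U K) (\<iota> x, k) C)"
proof -
  obtain h :: "'x \<Rightarrow> real" where h: "inj_on h (mspace X)"
    using X separable_metric_inj_real unfolding polish_metric_def by blast
  define g where "g = inv_into (mspace X) h"
  have g: "g (h x) = x" if "x \<in> mspace X" for x
    using that h unfolding g_def by simp
  define Y where "Y = metric (h ` mspace X, \<lambda>a b. mdist X (g a) (g b))"
  have MY: "Metric_space (h ` mspace X) (\<lambda>a b. mdist X (g a) (g b))"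
    by unfold_locales (auto simp: g mdist_commute mdist_triangle)
  have mY: "mspace Y = h ` mspace X" and dY: "mdist Y a b = mdist X (g a) (g b)" for a b
    unfolding Y_def by (simp_all add: Metric_space.mspace_metric[OF MY] Metric_space.mdist_metric[OF MY])
  have Y: "polish_metric Y"
    using X by (rule polish_metric_isometric[where f = h]) (auto simp: mY dY g)
  let ?f = "map_prod h id :: 'x \<times> 'b \<Rightarrow> real \<times> 'b"
  have f: "?f ` mspace (sum_metric X K) = mspace (sum_metric Y K)"
    by (simp add: mY map_prod_surj_on)
  have d: "mdist (sum_metric Y K) (?f p) (?f q) = mdist (sum_metric X K) p q"
    if "p \<in> mspace (sum_metric X K)" "q \<in> mspace (sum_metric X K)" for p q
    using that by (cases p; cases q) (auto simp: dY g)
  have Es: "E \<subseteq> mspace (sum_metric X K)"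
    using closedin_subset[OF E] by simp
  have "closedin (mtopology_of (sum_metric Y K)) (?f ` E)"
    using homeomorphic_map_closedness[OF isometry_homeomorphic[OF f d]] E Es by auto
  from univ[unfolded universal_def, rule_format, OF conjI[OF Y this]]
  obtain \<iota> where i: "isometric_embedding Y U \<iota>"
    and m: "\<And>y k. y \<in> mspace Y \<Longrightarrow> k \<in> mspace K \<Longrightarrow>
      minfdist (sum_metric Y K) (y, k) (?f ` E) = minfdist (sum_metric U K) (\<iota> y, k) C"
    by blast
  have "isometric_embedding X U (\<iota> \<circ> h)"
    using i by (auto simp: isometric_embedding_def mY dY g)
  moreover have "minfdist (sum_metric X K) (x, k) E = minfdist (sum_metric U K) ((\<iota> \<circ> h) x, k) C"
    if "x \<in> mspace X" "k \<in> mspace K" for x k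
  proof -
    have "minfdist (sum_metric Y K) (?f (x, k)) (?f ` E) = minfdist (sum_metric X K) (x, k) E"
      using that Es by (intro minfdist_image d) auto
    then show ?thesis using m[of "h x" k] that by (simp add: mY)
  qed
  ultimately show ?thesis by blast
qed

text \<open>
  For a universal \<open>C\<close> and a finite \<open>K\<^sub>0\<close> that is not all of \<open>K\<close>, there is a one-point isometry
  \<open>x \<mapsto> y\<close> that preserves the distances to \<open>C\<close> over \<open>K\<^sub>0\<close>, but no extension of which preserves
  them over \<open>K\<close>.
\<close>

lemma finite_agreement_insufficient:
  assumes univ: "universal U K C" and K\<^sub>0: "finite K\<^sub>0" "K\<^sub>0 \<subset> mspace K"
  shows "\<exists>x\<in>mspace U. \<exists>y\<in>mspace U.
     (\<forall>k\<in>K\<^sub>0. minfdist (sum_metric U K) (x, k) C = minfdist (sum_metric U K) (y, k) C) \<and>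
     (\<exists>k\<in>mspace K. minfdist (sum_metric U K) (x, k) C \<noteq> minfdist (sum_metric U K) (y, k) C)"
proof -
  obtain k' where k': "k' \<in> mspace K" "k' \<notin> K\<^sub>0" using K\<^sub>0 by blast
  define X where "X = submetric euclidean_metric {0, 1 :: real}"
  have mX: "mspace X = {0, 1}" by (simp add: X_def)
  interpret X: Metric_space "mspace X" "mdist X" by simp
  have "compact_space (mtopology_of X)"
    unfolding compact_space_def by (rule finite_imp_compactin) (simp_all add: mX)
  then have "mcomplete_of X"
    unfolding mcomplete_of_def mtopology_of_def by (rule X.compact_space_imp_mcomplete)
  moreover have "separable_space (mtopology_of X)"
    unfolding separable_space_def
    using closure_of_topspace[of "mtopology_of X"]
    by (intro exI[of _ "topspace (mtopology_of X)"]) (simp add: mX)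
  ultimately have X: "polish_metric X"
    by (simp add: polish_metric_def)
  define E where "E = insert (0 :: real, k') ({0, 1} \<times> K\<^sub>0)"
  have E: "finite E" "E \<noteq> {}" "E \<subseteq> mspace (sum_metric X K)"
    using K\<^sub>0 k' by (auto simp: E_def mX)
  have "Hausdorff_space (mtopology_of (sum_metric X K))"
    unfolding mtopology_of_def
    by (rule Metric_space.Hausdorff_space_mtopology[OF Metric_space_mspace_mdist])
  then have "closedin (mtopology_of (sum_metric X K)) E"
    using E by (intro closedin_Hausdorff_finite) auto
  from univ[unfolded universal_def, rule_format, OF conjI[OF X this]]
  obtain \<iota> where i: "isometric_embedding X U \<iota>"
    and m: "\<And>x k. x \<in> mspace X \<Longrightarrow> k \<in> mspace K \<Longrightarrow>
      minfdist (sum_metric X K) (x, k) E = minfdist (sum_metric U K) (\<iota> x, k) C"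
    by blast
  have z: "minfdist (sum_metric U K) (\<iota> x, k) C = 0 \<longleftrightarrow> (x, k) \<in> E"
    if "x \<in> {0, 1}" "k \<in> mspace K" for x k
    using m[of x k] minfdist_finite_eq_0_iff[OF E, of "(x, k)"] that by (simp add: mX)
  have "\<iota> 0 \<in> mspace U" "\<iota> 1 \<in> mspace U"
    using i by (auto simp: isometric_embedding_def mX)
  moreover have "\<forall>k\<in>K\<^sub>0. minfdist (sum_metric U K) (\<iota> 0, k) C = minfdist (sum_metric U K) (\<iota> 1, k) C"
  proof
    fix k assume k: "k \<in> K\<^sub>0"
    then have "k \<in> mspace K" using K\<^sub>0 by blast
    then show "minfdist (sum_metric U K) (\<iota> 0, k) C = minfdist (sum_metric U K) (\<iota> 1, k) C"
      using z[of 0 k] z[of 1 k] k by (simp add: E_def)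
  qed
  moreover have "minfdist (sum_metric U K) (\<iota> 0, k') C \<noteq> minfdist (sum_metric U K) (\<iota> 1, k') C"
    using z[of 0 k'] z[of 1 k'] k' by (auto simp: E_def)
  ultimately show ?thesis using k' by blast
qed

end

theory Submission
  imports Defs
begin

text \<open>
  The distance function \<open>F x k = dist ((x, k), C)\<close> of a closed set \<open>C\<close> assigns to every point \<open>x\<close> a
  nonnegative 1-Lipschitz function on \<open>K\<close>, its profile, and the profile depends on \<open>x\<close> in a
  1-Lipschitz way for the supremum distance.  So a closed subset of \<open>X \<times> K\<close> is treated as a
  1-Lipschitz map from \<open>X\<close> to the space of profiles.  The set \<open>C\<close> sought on the Urysohn space \<open>U\<close>
  is the zero set of a generic such map: one for which every one-point extension of a finite subset
  of \<open>U\<close>, together with any profile for the new point that respects the Lipschitz condition, is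
  realised in \<open>U\<close>.

  For a generic \<open>F\<close> the distance to the zero set is \<open>F\<close> itself (\<open>set_dist_zero_set\<close>).  The
  back-and-forth method shows that any two generic families on Polish spaces are isometric, by
  an isometry extending any given finite partial one, and that every Lipschitz family on a Polish space embeds
  (\<open>generic_isometry\<close>, \<open>generic_embedding\<close>).  This gives ultrahomogeneity and universality;
  agreement over a part \<open>K\<^sub>0\<close> of \<open>K\<close> is no harder than agreement over \<open>K\<close>, since the restriction of a
  generic family to profiles over \<open>K\<^sub>0\<close> is again generic (\<open>generic_subset\<close>).  Conversely a universal
  and ultrahomogeneous closed set has a generic distance function
  (\<open>universal_ultrahomogeneous_imp_generic\<close>), whence uniqueness.

  It remains to construct a generic family (\<open>generic_exists\<close>).  As \<open>K\<close> is compact, the profiles are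
  separable (\<open>profiles_separable\<close>), so that the extensions to be realised up to a small error can be
  listed as countably many tasks.  They are carried out one after another on finite subsets of
  \<open>U\<close>, where the Urysohn property supplies the points (\<open>nearly_generic_exists\<close>); the resulting
  partial family has a dense domain and extends to \<open>U\<close> by McShane's formula.  Completeness of \<open>U\<close>
  then turns approximate realisations into exact ones (\<open>nearly_generic_exact\<close>).
\<close>

section \<open>Completeness and separability in terms of distances\<close>

lemma polish_dense:
  assumes "polish_metric m"
  obtains D where "countable D" "D \<subseteq> mspace m"
    "\<And>x e. x \<in> mspace m \<Longrightarrow> 0 < e \<Longrightarrow> \<exists>y\<in>D. mdist m x y < e"
proof -
  interpret m: Metric_space "mspace m" "mdist m" by simp
  obtain D where D: "countable D" "D \<subseteq> mspace m" "m.mtopology closure_of D = mspace m"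
    using assms unfolding polish_metric_def separable_space_def mtopology_of_def by auto
  have "\<exists>y\<in>D. mdist m x y < e" if "x \<in> mspace m" "0 < e" for x e
  proof -
    have "x \<in> m.mtopology closure_of D" using that D by simp
    then show ?thesis using that unfolding m.metric_closure_of by auto
  qed
  with D that show thesis by blast
qed

lemma polish_limit:
  fixes s :: "nat \<Rightarrow> 'a"
  assumes m: "polish_metric m" and s: "\<And>n. s n \<in> mspace m"
    and cauchy: "\<And>e. 0 < e \<Longrightarrow> \<exists>N. \<forall>n\<ge>N. \<forall>n'\<ge>N. mdist m (s n) (s n') < e"
  obtains l where "l \<in> mspace m" "\<And>e. 0 < e \<Longrightarrow> \<exists>N. \<forall>n\<ge>N. mdist m (s n) l < e"
proof -
  interpret m: Metric_space "mspace m" "mdist m" by simp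
  have "m.MCauchy s"
    unfolding m.MCauchy_def using s cauchy by blast
  then obtain l where "limitin m.mtopology s l sequentially"
    using m unfolding polish_metric_def mcomplete_of_def m.mcomplete_def by blast
  then have "l \<in> mspace m" "\<And>e. 0 < e \<Longrightarrow> \<exists>N. \<forall>n\<ge>N. mdist m (s n) l < e"
    unfolding m.limit_metric_sequentially by blast+
  then show thesis by (rule that)
qed

lemma mdist_refl [simp]: "x \<in> mspace m \<Longrightarrow> mdist m x x = 0"
  by simp

section \<open>Infima of cones\<close>

text \<open>
  The McShane extension of the function \<open>a \<mapsto> r\<close>: the largest function that is 1-Lipschitz and
  does not exceed \<open>r\<close> at \<open>a\<close>, for each pair \<open>(a, r)\<close> in \<open>T\<close>.  The same formula builds the
  one-point extensions of a finite subspace, a countable dense set of Lipschitz functions on a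
  compact space, and the extension of a Lipschitz function from a dense set.
\<close>

definition envelope :: "'a metric \<Rightarrow> ('a \<times> real) set \<Rightarrow> 'a \<Rightarrow> real" where
  "envelope m T x = (INF (a, r)\<in>T. r + mdist m a x)"

lemma envelope_le:
  assumes "\<And>a r. (a, r) \<in> T \<Longrightarrow> 0 \<le> r" "(a, r) \<in> T"
  shows "envelope m T x \<le> r + mdist m a x"
proof -
  have "bdd_below ((\<lambda>(a, r). r + mdist m a x) ` T)"
    using assms(1) by (intro bdd_belowI[of _ 0]) auto
  then show ?thesis
    using cINF_lower[OF _ assms(2), of "\<lambda>(a, r). r + mdist m a x"] by (simp add: envelope_def)
qed

lemma envelope_ge:
  assumes "T \<noteq> {}" "\<And>a r. (a, r) \<in> T \<Longrightarrow> c \<le> r + mdist m a x"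
  shows "c \<le> envelope m T x"
  unfolding envelope_def using assms by (intro cINF_greatest) auto

lemma envelope_lipschitz:
  assumes T: "T \<noteq> {}" "\<And>a r. (a, r) \<in> T \<Longrightarrow> a \<in> mspace m \<and> 0 \<le> r"
    and x: "x \<in> mspace m" and y: "y \<in> mspace m"
  shows "envelope m T x \<le> envelope m T y + mdist m x y"
proof -
  have "envelope m T x - mdist m x y \<le> envelope m T y"
  proof (rule envelope_ge[OF T(1)])
    fix a r assume a: "(a, r) \<in> T"
    have "envelope m T x \<le> r + mdist m a x"
      using T(2) a by (intro envelope_le) auto
    also have "mdist m a x \<le> mdist m a y + mdist m y x"
      using T(2)[OF a] x y by (intro mdist_triangle) auto
    finally show "envelope m T x - mdist m x y \<le> r + mdist m a y"
      by (simp add: mdist_commute)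
  qed
  then show ?thesis by linarith
qed

lemma envelope_attained:
  assumes "finite T" "T \<noteq> {}"
  obtains a r where "(a, r) \<in> T" "envelope m T x = r + mdist m a x"
proof -
  let ?f = "\<lambda>(a, r). r + mdist m a x"
  have "envelope m T x = Min (?f ` T)"
    using assms unfolding envelope_def by (simp add: cInf_eq_Min)
  also have "\<dots> \<in> ?f ` T"
    using assms by (intro Min_in) auto
  finally show thesis using that by auto
qed

section \<open>Countably many requirements on a set with a pairwise relation\<close>

text \<open>
  The Rasiowa--Sikorski lemma.  Conditions are the finite sets whose elements are pairwise
  related, ordered by inclusion; if each of countably many requirements can be met by enlarging
  any condition, the union of a suitable chain of conditions meets all of them.  Both
  the back-and-forth method and the construction of a generic family are instances, so that
  neither has to organise an enumeration of tasks.
\<close>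

lemma Rasiowa_Sikorski:
  assumes I: "countable I" and p0: "finite p0" "\<forall>s\<in>p0. \<forall>t\<in>p0. P s t"
    and dense: "\<And>p i. finite p \<Longrightarrow> \<forall>s\<in>p. \<forall>t\<in>p. P s t \<Longrightarrow> i \<in> I \<Longrightarrow>
      \<exists>q. p \<subseteq> q \<and> finite q \<and> (\<forall>s\<in>q. \<forall>t\<in>q. P s t) \<and> Q i q"
  obtains R where "p0 \<subseteq> R" "\<And>s t. s \<in> R \<Longrightarrow> t \<in> R \<Longrightarrow> P s t" "\<And>i. i \<in> I \<Longrightarrow> \<exists>p\<subseteq>R. Q i p"
proof (cases "I = {}")
  case True
  with p0 show thesis by (intro that[of p0]) auto
next
  case False
  define good where "good p \<longleftrightarrow> p0 \<subseteq> p \<and> finite p \<and> (\<forall>s\<in>p. \<forall>t\<in>p. P s t)" for p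
  have "\<exists>f. \<forall>n. good (f n) \<and> (f n \<subseteq> f (Suc n) \<and> Q (from_nat_into I n) (f (Suc n)))"
  proof (rule dependent_nat_choice)
    show "\<exists>p. good p" using p0 by (auto simp: good_def)
    show "\<exists>q. good q \<and> (p \<subseteq> q \<and> Q (from_nat_into I n) q)" if "good p" for p n
      using dense[of p "from_nat_into I n"] that from_nat_into[OF False, of n]
      unfolding good_def by (meson subset_trans)
  qed
  then obtain f where f: "\<And>n. good (f n)" "\<And>n. f n \<subseteq> f (Suc n)"
    "\<And>n. Q (from_nat_into I n) (f (Suc n))" by blast
  have mono: "f n \<subseteq> f n'" if "n \<le> n'" for n n'
    using lift_Suc_mono_le[of f] f(2) that by blast
  show thesis
  proof (rule that[of "\<Union>n. f n"])
    show "p0 \<subseteq> (\<Union>n. f n)" using f(1)[of 0] unfolding good_def by blast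
    show "P s t" if st: "s \<in> (\<Union>n. f n)" "t \<in> (\<Union>n. f n)" for s t
    proof -
      obtain i j where "s \<in> f i" "t \<in> f j" using st by blast
      then have "s \<in> f (max i j)" "t \<in> f (max i j)"
        using mono[of i "max i j"] mono[of j "max i j"] by auto
      then show ?thesis using f(1) by (auto simp: good_def)
    qed
    show "\<exists>p\<subseteq>(\<Union>n. f n). Q i p" if "i \<in> I" for i
      using from_nat_into_surj[OF I that] f(3) by blast
  qed
qed

lemma pairwise_insert_iff:
  "(\<forall>s\<in>insert x p. \<forall>t\<in>insert x p. P s t) \<longleftrightarrow>
   P x x \<and> (\<forall>s\<in>p. P s x \<and> P x s) \<and> (\<forall>s\<in>p. \<forall>t\<in>p. P s t)"
  by auto

section \<open>Lipschitz families and genericity\<close>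

text \<open>
  The values \<open>F x k = dist ((x, k), C)\<close> form a family of profiles \<open>F x\<close> on \<open>K\<close>, that is, of
  nonnegative 1-Lipschitz functions, which depends on \<open>x\<close> in a 1-Lipschitz way with respect to
  the supremum distance.  The set \<open>S \<subseteq> K\<close> allows for looking at distances over a part of \<open>K\<close>
  only.
\<close>

definition profile :: "'k metric \<Rightarrow> 'k set \<Rightarrow> ('k \<Rightarrow> real) \<Rightarrow> bool" where
  "profile K S g \<longleftrightarrow> (\<forall>k\<in>S. 0 \<le> g k \<and> (\<forall>l\<in>S. g k \<le> g l + mdist K k l))"

definition lip_family :: "'u metric \<Rightarrow> 'k metric \<Rightarrow> 'k set \<Rightarrow> ('u \<Rightarrow> 'k \<Rightarrow> real) \<Rightarrow> bool" where
  "lip_family U K S F \<longleftrightarrow> (\<forall>x\<in>mspace U. profile K S (F x)) \<and>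
     (\<forall>x\<in>mspace U. \<forall>y\<in>mspace U. \<forall>k\<in>S. F x k \<le> F y k + mdist U x y)"

lemma profile_nonneg: "profile K S g \<Longrightarrow> k \<in> S \<Longrightarrow> 0 \<le> g k"
  by (simp add: profile_def)

lemma profileD: "profile K S g \<Longrightarrow> k \<in> S \<Longrightarrow> l \<in> S \<Longrightarrow> g k \<le> g l + mdist K k l"
  by (simp add: profile_def)

lemma lip_family_profile: "lip_family U K S F \<Longrightarrow> x \<in> mspace U \<Longrightarrow> profile K S (F x)"
  by (simp add: lip_family_def)

lemma lip_familyD:
  "lip_family U K S F \<Longrightarrow> x \<in> mspace U \<Longrightarrow> y \<in> mspace U \<Longrightarrow> k \<in> S \<Longrightarrow>
   F x k \<le> F y k + mdist U x y"
  by (simp add: lip_family_def)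

lemma lip_family_abs:
  assumes "lip_family U K S F" "x \<in> mspace U" "y \<in> mspace U" "k \<in> S"
  shows "\<bar>F x k - F y k\<bar> \<le> mdist U x y"
proof -
  have "F x k \<le> F y k + mdist U x y" "F y k \<le> F x k + mdist U y x"
    using lip_familyD[OF assms(1)] assms(2-4) by auto
  then show ?thesis by (simp add: mdist_commute abs_le_iff)
qed

text \<open>The functions that can be the distances from the points of \<open>A\<close> to a further point.\<close>

definition katetov :: "'u metric \<Rightarrow> 'u set \<Rightarrow> ('u \<Rightarrow> real) \<Rightarrow> bool" where
  "katetov U A f \<longleftrightarrow> (\<forall>a\<in>A. \<forall>b\<in>A. f a \<le> f b + mdist U a b \<and> mdist U a b \<le> f a + f b)"

lemma katetovD:
  assumes "katetov U A f" "a \<in> A" "b \<in> A"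
  shows "f a \<le> f b + mdist U a b" "mdist U a b \<le> f a + f b"
  using assms by (simp_all add: katetov_def)

lemma katetov_nonneg: "katetov U A f \<Longrightarrow> a \<in> A \<Longrightarrow> 0 \<le> f a"
  using katetovD(2)[of U A f a a] mdist_nonneg[of U a a] by linarith

text \<open>
  The Urysohn property for metric spaces with a Lipschitz family of profiles: every one-point
  extension of a finite subspace, together with a profile for the new point that respects the
  Lipschitz condition, is realised.
\<close>

definition generic :: "'u metric \<Rightarrow> 'k metric \<Rightarrow> 'k set \<Rightarrow> ('u \<Rightarrow> 'k \<Rightarrow> real) \<Rightarrow> bool" where
  "generic U K S F \<longleftrightarrow> lip_family U K S F \<and>
     (\<forall>A f g. finite A \<and> A \<subseteq> mspace U \<and> katetov U A f \<and> profile K S g \<and>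
        (\<forall>a\<in>A. \<forall>k\<in>S. \<bar>F a k - g k\<bar> \<le> f a) \<longrightarrow>
        (\<exists>z\<in>mspace U. (\<forall>a\<in>A. mdist U z a = f a) \<and> (\<forall>k\<in>S. F z k = g k)))"

lemma generic_lip: "generic U K S F \<Longrightarrow> lip_family U K S F"
  by (simp add: generic_def)

lemma genericD:
  assumes "generic U K S F" "finite A" "A \<subseteq> mspace U" "katetov U A f" "profile K S g"
    "\<And>a k. a \<in> A \<Longrightarrow> k \<in> S \<Longrightarrow> \<bar>F a k - g k\<bar> \<le> f a"
  obtains z where "z \<in> mspace U" "\<And>a. a \<in> A \<Longrightarrow> mdist U z a = f a" "\<And>k. k \<in> S \<Longrightarrow> F z k = g k"
proof -
  have "\<exists>z\<in>mspace U. (\<forall>a\<in>A. mdist U z a = f a) \<and> (\<forall>k\<in>S. F z k = g k)"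
    by (rule assms(1)[unfolded generic_def, THEN conjunct2, rule_format]) (intro conjI ballI assms)
  then show thesis using that by blast
qed

text \<open>
  Profiles over \<open>S\<close> only are no obstacle: a profile \<open>g\<close> on \<open>S\<close> extends to \<open>K\<close> by McShane's
  formula for the function on \<open>A \<times> K \<union> {z} \<times> S\<close> given by \<open>F\<close> and \<open>g\<close>.  This is why agreement
  over a part \<open>K\<^sub>0\<close> of \<open>K\<close> suffices for an extension with agreement over \<open>K\<^sub>0\<close>.
\<close>

lemma generic_subset:
  assumes gen: "generic U K (mspace K) F" and S: "S \<subseteq> mspace K"
  shows "generic U K S F"
  unfolding generic_def
proof (intro conjI allI impI)
  have lip: "lip_family U K (mspace K) F" using gen by (rule generic_lip)
  then show "lip_family U K S F"
    using S unfolding lip_family_def profile_def by (meson subsetD)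
  fix A f g
  assume a: "finite A \<and> A \<subseteq> mspace U \<and> katetov U A f \<and> profile K S g \<and>
    (\<forall>a\<in>A. \<forall>k\<in>S. \<bar>F a k - g k\<bar> \<le> f a)"
  then have A: "finite A" "A \<subseteq> mspace U" and kat: "katetov U A f" and g: "profile K S g"
    and Fg: "\<And>a k. a \<in> A \<Longrightarrow> k \<in> S \<Longrightarrow> \<bar>F a k - g k\<bar> \<le> f a" by blast+
  have f0: "0 \<le> f a" if "a \<in> A" for a using kat that by (rule katetov_nonneg)
  show "\<exists>z\<in>mspace U. (\<forall>a\<in>A. mdist U z a = f a) \<and> (\<forall>k\<in>S. F z k = g k)"
  proof (cases "A = {} \<and> S = {}")
    case True
    obtain z where "z \<in> mspace U"
      by (rule genericD[OF gen, of "{}" f "\<lambda>_. 0"]) (auto simp: katetov_def profile_def)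
    then show ?thesis using True by auto
  next
    case False
    define J where "J = (\<lambda>s k. g s + mdist K s k) ` S \<union> (\<lambda>a k. F a k + f a) ` A"
    define h where "h k = (INF j\<in>J. j k)" for k
    have J: "J \<noteq> {}" using False by (auto simp: J_def)
    have J0: "0 \<le> j k" if "j \<in> J" "k \<in> mspace K" for j k
      using that(1) unfolding J_def
    proof
      assume "j \<in> (\<lambda>s k. g s + mdist K s k) ` S"
      then show ?thesis using profile_nonneg[OF g] by auto
    next
      assume "j \<in> (\<lambda>a k. F a k + f a) ` A"
      then obtain a where "a \<in> A" "j = (\<lambda>k. F a k + f a)" by blast
      then show ?thesis
        using profile_nonneg[OF lip_family_profile[OF lip], of a k] A f0[of a] that(2) by auto
    qed
    have le: "h k \<le> j k" if "j \<in> J" "k \<in> mspace K" for j k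
      unfolding h_def using that J0 by (intro cINF_lower bdd_belowI[of _ 0]) auto
    have ge: "c \<le> h k" if "\<And>j. j \<in> J \<Longrightarrow> c \<le> j k" for c k
      unfolding h_def using J that by (intro cINF_greatest) auto
    have Jlip: "j k \<le> j l + mdist K k l" if "j \<in> J" "k \<in> mspace K" "l \<in> mspace K" for j k l
      using that(1) unfolding J_def
    proof
      assume "j \<in> (\<lambda>s k. g s + mdist K s k) ` S"
      then obtain s where s: "s \<in> S" "j = (\<lambda>k. g s + mdist K s k)" by blast
      then show ?thesis
        using mdist_triangle[of s K l k] that S by (auto simp: mdist_commute)
    next
      assume "j \<in> (\<lambda>a k. F a k + f a) ` A"
      then obtain a where "a \<in> A" "j = (\<lambda>k. F a k + f a)" by blast
      then show ?thesis
        using profileD[OF lip_family_profile[OF lip], of a k l] A that by auto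
    qed
    have h: "profile K (mspace K) h"
      unfolding profile_def
    proof (intro ballI conjI)
      fix k l assume k: "k \<in> mspace K" and l: "l \<in> mspace K"
      show "0 \<le> h k" using J0 k by (intro ge) auto
      have "h k - mdist K k l \<le> h l"
      proof (rule ge)
        fix j assume "j \<in> J"
        then show "h k - mdist K k l \<le> j l" using le[of j k] Jlip[of j k l] k l by linarith
      qed
      then show "h k \<le> h l + mdist K k l" by linarith
    qed
    have hg: "h k = g k" if k: "k \<in> S" for k
    proof (rule antisym)
      have "(\<lambda>l. g k + mdist K k l) \<in> J" using k by (auto simp: J_def)
      then have "h k \<le> g k + mdist K k k" using le k S by blast
      moreover have "mdist K k k = 0" using k S by auto
      ultimately show "h k \<le> g k" by simp
      show "g k \<le> h k"
      proof (rule ge)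
        fix j assume "j \<in> J"
        then consider s where "s \<in> S" "j = (\<lambda>k. g s + mdist K s k)"
          | a where "a \<in> A" "j = (\<lambda>k. F a k + f a)" unfolding J_def by blast
        then show "g k \<le> j k"
        proof cases
          case 1
          then have "g k \<le> g s + mdist K k s" using profileD[OF g k] by blast
          then show ?thesis using 1 by (simp add: mdist_commute)
        next
          case 2
          then show ?thesis using Fg[of a k] k by simp
        qed
      qed
    qed
    have Fh: "\<bar>F a k - h k\<bar> \<le> f a" if a: "a \<in> A" and k: "k \<in> mspace K" for a k
    proof -
      have "h k \<le> F a k + f a"
        using le[of "\<lambda>k. F a k + f a" k] a k by (auto simp: J_def)
      moreover have "F a k - f a \<le> h k"
      proof (rule ge)
        fix j assume "j \<in> J"
        then consider s where "s \<in> S" "j = (\<lambda>k. g s + mdist K s k)"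
          | b where "b \<in> A" "j = (\<lambda>k. F b k + f b)" unfolding J_def by blast
        then show "F a k - f a \<le> j k"
        proof cases
          case 1
          then have "F a k \<le> F a s + mdist K k s"
            using profileD[OF lip_family_profile[OF lip], of a k s] a k A S by blast
          then show ?thesis using Fg[OF a, of s] 1 by (simp add: mdist_commute)
        next
          case 2
          then have "F a k \<le> F b k + mdist U a b" "mdist U a b \<le> f a + f b"
            using lip_familyD[OF lip, of a b k] katetovD(2)[OF kat a] a k A by auto
          then show ?thesis using 2 by simp
        qed
      qed
      ultimately show ?thesis by linarith
    qed
    obtain z where "z \<in> mspace U" "\<And>a. a \<in> A \<Longrightarrow> mdist U z a = f a"
      "\<And>k. k \<in> mspace K \<Longrightarrow> F z k = h k"
      using genericD[OF gen A kat h Fh] by blast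
    then show ?thesis using hg S by (intro bexI[of _ z]) auto
  qed
qed

section \<open>Back and forth\<close>

text \<open>
  A set of pairs all of which are related in this way is a partial isometry that preserves
  profiles over \<open>S\<close>.  Relations rather than partial functions make the two directions symmetric.
\<close>

definition matching ::
  "'x metric \<Rightarrow> 'y metric \<Rightarrow> 'k set \<Rightarrow> ('x \<Rightarrow> 'k \<Rightarrow> real) \<Rightarrow> ('y \<Rightarrow> 'k \<Rightarrow> real) \<Rightarrow>
   'x \<times> 'y \<Rightarrow> 'x \<times> 'y \<Rightarrow> bool" where
  "matching X Y S F G p q \<longleftrightarrow> fst p \<in> mspace X \<and> snd p \<in> mspace Y \<and>
     mdist X (fst p) (fst q) = mdist Y (snd p) (snd q) \<and> (\<forall>k\<in>S. F (fst p) k = G (snd p) k)"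

lemma matching_swap:
  "matching Y X S G F (prod.swap p) (prod.swap q) = matching X Y S F G p q"
  unfolding matching_def by auto

lemma matching_swap_all:
  "(\<forall>s\<in>prod.swap ` p. \<forall>t\<in>prod.swap ` p. matching Y X S G F s t) \<longleftrightarrow>
   (\<forall>s\<in>p. \<forall>t\<in>p. matching X Y S F G s t)"
  by (simp add: matching_swap)

lemma matching_extend:
  assumes F: "lip_family X K S F" and G: "generic Y K S G"
    and p: "finite p" "\<forall>s\<in>p. \<forall>t\<in>p. matching X Y S F G s t" and x: "x \<in> mspace X"
  obtains y where "\<forall>s\<in>insert (x, y) p. \<forall>t\<in>insert (x, y) p. matching X Y S F G s t"
proof -
  have P: "a \<in> mspace X" "b \<in> mspace Y" "\<And>k. k \<in> S \<Longrightarrow> F a k = G b k" if "(a, b) \<in> p" for a b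
    using p(2) that unfolding matching_def by fastforce+
  have d: "mdist X a a' = mdist Y b b'" if "(a, b) \<in> p" "(a', b') \<in> p" for a a' b b'
    using p(2) that unfolding matching_def by fastforce
  define c where "c b = (SOME a. (a, b) \<in> p)" for b
  have c: "(c b, b) \<in> p" if "(a, b) \<in> p" for a b
    unfolding c_def using that by (rule someI)
  have ca: "c b = a" if "(a, b) \<in> p" for a b
  proof -
    have "mdist Y b b = 0" using P(2)[OF that] by simp
    then have "mdist X (c b) a = 0" using d[OF c[OF that] that] by simp
    then show ?thesis using P(1)[OF that] P(1)[OF c[OF that]] by simp
  qed
  define f where "f b = mdist X x (c b)" for b
  have "katetov Y (Range p) f"
    unfolding katetov_def
  proof (intro ballI)
    fix b b' assume "b \<in> Range p" "b' \<in> Range p"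
    then have b: "(c b, b) \<in> p" "(c b', b') \<in> p" using c by blast+
    have "mdist X x (c b) \<le> mdist X x (c b') + mdist X (c b') (c b)"
      "mdist X (c b) (c b') \<le> mdist X (c b) x + mdist X x (c b')"
      using b P x by (auto intro!: mdist_triangle)
    then show "f b \<le> f b' + mdist Y b b' \<and> mdist Y b b' \<le> f b + f b'"
      using d[OF b] by (simp add: f_def mdist_commute)
  qed
  moreover have "profile K S (F x)" using F x by (simp add: lip_family_def)
  moreover have "\<bar>G b k - F x k\<bar> \<le> f b" if "b \<in> Range p" "k \<in> S" for b k
  proof -
    have b: "(c b, b) \<in> p" using that c by blast
    have "\<bar>F x k - F (c b) k\<bar> \<le> mdist X x (c b)"
      using lip_family_abs[OF F x P(1)[OF b]] that by blast
    then show ?thesis using P(3)[OF b \<open>k \<in> S\<close>] by (simp add: f_def abs_minus_commute)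
  qed
  moreover have "finite (Range p)" "Range p \<subseteq> mspace Y" using p P by (auto simp: finite_Range)
  ultimately obtain y where y: "y \<in> mspace Y" "\<And>b. b \<in> Range p \<Longrightarrow> mdist Y y b = f b"
    "\<And>k. k \<in> S \<Longrightarrow> G y k = F x k"
    using genericD[OF G, of "Range p" f "F x"] by blast
  have new: "mdist Y y b = mdist X x a" "mdist Y b y = mdist X a x" if "(a, b) \<in> p" for a b
    using y(2)[of b] ca[OF that] that by (auto simp: f_def mdist_commute)
  have "matching X Y S F G s t" if st: "s \<in> insert (x, y) p" "t \<in> insert (x, y) p" for s t
  proof -
    have "mdist X x x = mdist Y y y" using x y(1) by simp
    then have self: "matching X Y S F G (x, y) (x, y)"
      using x y(1,3) by (simp add: matching_def)
    have "matching X Y S F G (x, y) (a, b)" "matching X Y S F G (a, b) (x, y)"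
      if "(a, b) \<in> p" for a b
      using x y(1,3) new[OF that] P[OF that] by (simp_all add: matching_def)
    with self st p(2) show ?thesis by (cases s; cases t) auto
  qed
  then show thesis by (intro that[of y]) blast
qed

text \<open>
  A nonempty \<open>E\<close> asks for going back as well as forth, which the source allows if it is generic;
  \<open>E = {}\<close> is the construction of an embedding.
\<close>

lemma matching_chain:
  assumes F: "lip_family X K S F" and G: "generic Y K S G"
    and p: "finite p" "\<forall>s\<in>p. \<forall>t\<in>p. matching X Y S F G s t"
    and D: "countable D" "D \<subseteq> mspace X" and E: "countable E" "E \<subseteq> mspace Y"
    and retro: "E \<noteq> {} \<Longrightarrow> generic X K S F"
  obtains R where "p \<subseteq> R" "\<And>s t. s \<in> R \<Longrightarrow> t \<in> R \<Longrightarrow> matching X Y S F G s t"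
    "D \<subseteq> Domain R" "E \<subseteq> Range R"
proof -
  let ?Q = "\<lambda>i q. case i of Inl x \<Rightarrow> x \<in> Domain q | Inr y \<Rightarrow> y \<in> Range q"
  show thesis
  proof (rule Rasiowa_Sikorski[of "D <+> E" p "matching X Y S F G" ?Q])
    show "countable (D <+> E)" using D E by simp
    fix q i
    assume q: "finite q" "\<forall>s\<in>q. \<forall>t\<in>q. matching X Y S F G s t" and "i \<in> D <+> E"
    then consider x where "x \<in> D" "i = Inl x" | y where "y \<in> E" "i = Inr y" by blast
    then show "\<exists>q'. q \<subseteq> q' \<and> finite q' \<and> (\<forall>s\<in>q'. \<forall>t\<in>q'. matching X Y S F G s t) \<and> ?Q i q'"
    proof cases
      case (1 x)
      then have x: "x \<in> mspace X" using D by blast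
      obtain y where "\<forall>s\<in>insert (x, y) q. \<forall>t\<in>insert (x, y) q. matching X Y S F G s t"
        using matching_extend[OF F G q x] by blast
      then show ?thesis using q 1 by (intro exI[of _ "insert (x, y) q"]) auto
    next
      case (2 y)
      then have y: "y \<in> mspace Y" and ne: "E \<noteq> {}" using E by auto
      have q': "\<forall>s\<in>prod.swap ` q. \<forall>t\<in>prod.swap ` q. matching Y X S G F s t"
        using q(2) by (simp only: matching_swap_all)
      have "finite (prod.swap ` q)" using q(1) by simp
      then obtain x where x: "\<forall>s\<in>insert (y, x) (prod.swap ` q). \<forall>t\<in>insert (y, x) (prod.swap ` q).
          matching Y X S G F s t"
        using matching_extend[OF generic_lip[OF G] retro[OF ne] _ q' y] by metis
      have "insert (y, x) (prod.swap ` q) = prod.swap ` insert (x, y) q" by simp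
      then have "\<forall>s\<in>insert (x, y) q. \<forall>t\<in>insert (x, y) q. matching X Y S F G s t"
        using x by (simp only: matching_swap_all)
      then show ?thesis using q 2 by (intro exI[of _ "insert (x, y) q"]) auto
    qed
  next
    fix R
    assume R: "p \<subseteq> R" "\<And>s t. s \<in> R \<Longrightarrow> t \<in> R \<Longrightarrow> matching X Y S F G s t"
      and req: "\<And>i. i \<in> D <+> E \<Longrightarrow> \<exists>q\<subseteq>R. ?Q i q"
    show thesis
    proof (rule that[OF R])
      show "D \<subseteq> Domain R" using req[of "Inl _"] by fastforce
      show "E \<subseteq> Range R" using req[of "Inr _"] by fastforce
    qed
  qed (use p in auto)
qed

text \<open>
  A dense partial isometry is completed by passing to its closure in \<open>X \<times> Y\<close>, which again
  consists of matching pairs because all data are continuous.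
\<close>

definition closure_rel :: "'x metric \<Rightarrow> 'y metric \<Rightarrow> ('x \<times> 'y) set \<Rightarrow> ('x \<times> 'y) set" where
  "closure_rel X Y R = {(x, y). x \<in> mspace X \<and> y \<in> mspace Y \<and>
     (\<forall>e>0. \<exists>a b. (a, b) \<in> R \<and> mdist X x a < e \<and> mdist Y y b < e)}"

lemma closure_relD:
  assumes "(x, y) \<in> closure_rel X Y R"
  shows "x \<in> mspace X" "y \<in> mspace Y"
    "0 < e \<Longrightarrow> \<exists>a b. (a, b) \<in> R \<and> mdist X x a < e \<and> mdist Y y b < e"
  using assms by (simp_all add: closure_rel_def)

lemma closure_rel_swap: "closure_rel Y X (prod.swap ` R) = prod.swap ` closure_rel X Y R"
proof -
  have "(y, x) \<in> closure_rel Y X (prod.swap ` R) \<longleftrightarrow> (x, y) \<in> closure_rel X Y R" for x y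
  proof -
    have "(b, a) \<in> prod.swap ` R \<longleftrightarrow> (a, b) \<in> R" for a b by force
    then show ?thesis unfolding closure_rel_def mem_Collect_eq case_prod_conv by meson
  qed
  then show ?thesis by force
qed

lemma mdist_perturb:
  assumes "x \<in> mspace m" "x' \<in> mspace m" "a \<in> mspace m" "a' \<in> mspace m"
  shows "\<bar>mdist m x x' - mdist m a a'\<bar> \<le> mdist m x a + mdist m x' a'"
proof -
  have "mdist m x x' \<le> mdist m x a + mdist m a x'" "mdist m a x' \<le> mdist m a a' + mdist m a' x'"
    "mdist m a a' \<le> mdist m a x + mdist m x a'" "mdist m x a' \<le> mdist m x x' + mdist m x' a'"
    using assms by (auto intro!: mdist_triangle)
  then show ?thesis by (simp add: mdist_commute abs_le_iff)
qed

lemma matching_closure: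
  assumes F: "lip_family X K S F" and G: "lip_family Y K S G"
    and R: "\<And>s t. s \<in> R \<Longrightarrow> t \<in> R \<Longrightarrow> matching X Y S F G s t"
    and st: "s \<in> closure_rel X Y R" "t \<in> closure_rel X Y R"
  shows "matching X Y S F G s t"
proof -
  obtain x y x' y' where s: "s = (x, y)" and t: "t = (x', y')" by (metis prod.exhaust)
  have xy: "x \<in> mspace X" "y \<in> mspace Y" "x' \<in> mspace X" "y' \<in> mspace Y"
    and close: "\<And>e. 0 < e \<Longrightarrow> \<exists>a b. (a, b) \<in> R \<and> mdist X x a < e \<and> mdist Y y b < e"
      "\<And>e. 0 < e \<Longrightarrow> \<exists>a b. (a, b) \<in> R \<and> mdist X x' a < e \<and> mdist Y y' b < e"
    using closure_relD[OF st(1)[unfolded s]] closure_relD[OF st(2)[unfolded t]] by blast+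
  have P: "a \<in> mspace X" "b \<in> mspace Y" "\<And>k. k \<in> S \<Longrightarrow> F a k = G b k"
    "mdist X a a' = mdist Y b b'" if "(a, b) \<in> R" "(a', b') \<in> R" for a b a' b'
    using R[OF that] unfolding matching_def by auto
  have "\<bar>mdist X x x' - mdist Y y y'\<bar> \<le> 0"
  proof (rule field_le_epsilon)
    fix e :: real assume "0 < e"
    then have e: "0 < e / 4" by simp
    obtain a b a' b' where ab: "(a, b) \<in> R" "(a', b') \<in> R"
      and d: "mdist X x a < e / 4" "mdist Y y b < e / 4" "mdist X x' a' < e / 4" "mdist Y y' b' < e / 4"
      using close(1)[OF e] close(2)[OF e] by blast
    have "\<bar>mdist X x x' - mdist X a a'\<bar> \<le> mdist X x a + mdist X x' a'"
      "\<bar>mdist Y y y' - mdist Y b b'\<bar> \<le> mdist Y y b + mdist Y y' b'"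
      using P(1,2)[OF ab] P(1,2)[OF ab(2,1)] xy by (auto intro!: mdist_perturb)
    then show "\<bar>mdist X x x' - mdist Y y y'\<bar> \<le> 0 + e"
      using d P(4)[OF ab] by linarith
  qed
  moreover have "\<bar>F x k - G y k\<bar> \<le> 0" if k: "k \<in> S" for k
  proof (rule field_le_epsilon)
    fix e :: real assume "0 < e"
    then have e: "0 < e / 2" by simp
    obtain a b where ab: "(a, b) \<in> R" and d: "mdist X x a < e / 2" "mdist Y y b < e / 2"
      using close(1)[OF e] by blast
    have "\<bar>F x k - F a k\<bar> \<le> mdist X x a" "\<bar>G y k - G b k\<bar> \<le> mdist Y y b"
      using lip_family_abs[OF F] lip_family_abs[OF G] P(1,2)[OF ab ab] xy k by auto
    then show "\<bar>F x k - G y k\<bar> \<le> 0 + e"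
      using d P(3)[OF ab ab k] by linarith
  qed
  ultimately show ?thesis
    using xy by (simp add: matching_def s t)
qed

lemma closure_rel_total:
  assumes Y: "polish_metric Y"
    and R: "\<And>s t. s \<in> R \<Longrightarrow> t \<in> R \<Longrightarrow> matching X Y S F G s t"
    and dense: "\<And>e. 0 < e \<Longrightarrow> \<exists>a\<in>Domain R. mdist X x a < e" and x: "x \<in> mspace X"
  obtains y where "(x, y) \<in> closure_rel X Y R"
proof -
  have P: "a \<in> mspace X" "b \<in> mspace Y" "mdist X a a' = mdist Y b b'"
    if "(a, b) \<in> R" "(a', b') \<in> R" for a b a' b'
    using R[OF that] unfolding matching_def by auto
  have "\<forall>n. \<exists>ab\<in>R. mdist X x (fst ab) < inverse (real (Suc n))"
  proof
    fix n
    obtain a b where "(a, b) \<in> R" "mdist X x a < inverse (real (Suc n))"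
      using dense[of "inverse (real (Suc n))"] by auto
    then show "\<exists>ab\<in>R. mdist X x (fst ab) < inverse (real (Suc n))" by force
  qed
  then obtain s where s: "\<And>n. s n \<in> R" "\<And>n. mdist X x (fst (s n)) < inverse (real (Suc n))"
    by metis
  have sm: "fst (s n) \<in> mspace X" "snd (s n) \<in> mspace Y" for n
    using P(1,2)[of "fst (s n)" "snd (s n)" "fst (s n)" "snd (s n)"] s(1)[of n] by simp_all
  have near: "\<exists>N. \<forall>n\<ge>N. mdist X x (fst (s n)) < e" if "0 < e" for e
  proof -
    obtain N where N: "inverse (real (Suc N)) < e" using reals_Archimedean \<open>0 < e\<close> by blast
    have "mdist X x (fst (s n)) < e" if "N \<le> n" for n
    proof -
      have "inverse (real (Suc n)) \<le> inverse (real (Suc N))" using that by simp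
      then show ?thesis using s(2)[of n] N by linarith
    qed
    then show ?thesis by blast
  qed
  have "\<exists>N. \<forall>n\<ge>N. \<forall>n'\<ge>N. mdist Y (snd (s n)) (snd (s n')) < e" if e: "0 < e" for e
  proof -
    obtain N where N: "\<And>n. n \<ge> N \<Longrightarrow> mdist X x (fst (s n)) < e / 2"
      using near[of "e / 2"] e by auto
    have "mdist Y (snd (s n)) (snd (s n')) < e" if "n \<ge> N" "n' \<ge> N" for n n'
    proof -
      have "mdist X (fst (s n)) (fst (s n')) \<le> mdist X (fst (s n)) x + mdist X x (fst (s n'))"
        using sm x by (intro mdist_triangle) auto
      then show ?thesis
        using N[of n] N[of n'] that P(3)[of "fst (s n)" "snd (s n)" "fst (s n')" "snd (s n')"] s(1)
        by (simp add: mdist_commute)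
    qed
    then show ?thesis by blast
  qed
  then obtain y where y: "y \<in> mspace Y" "\<And>e. 0 < e \<Longrightarrow> \<exists>N. \<forall>n\<ge>N. mdist Y (snd (s n)) y < e"
    using polish_limit[OF Y, of "\<lambda>n. snd (s n)"] sm(2) by metis
  have "\<exists>a b. (a, b) \<in> R \<and> mdist X x a < e \<and> mdist Y y b < e" if e: "0 < e" for e
  proof -
    obtain N N' where "\<forall>n\<ge>N. mdist X x (fst (s n)) < e" "\<forall>n\<ge>N'. mdist Y (snd (s n)) y < e"
      using near[OF e] y(2)[OF e] by blast
    then have "mdist X x (fst (s (max N N'))) < e" "mdist Y y (snd (s (max N N'))) < e"
      by (auto simp: mdist_commute)
    then show ?thesis
      using s(1)[of "max N N'"]
      by (intro exI[of _ "fst (s (max N N'))"] exI[of _ "snd (s (max N N'))"]) simp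
  qed
  then show thesis using x y by (intro that[of y]) (simp add: closure_rel_def)
qed

lemma subset_closure_rel:
  assumes "\<And>s t. s \<in> R \<Longrightarrow> t \<in> R \<Longrightarrow> matching X Y S F G s t"
  shows "R \<subseteq> closure_rel X Y R"
proof
  fix s assume s: "s \<in> R"
  obtain x y where xy: "s = (x, y)" by (metis prod.exhaust)
  then have "x \<in> mspace X" "y \<in> mspace Y" using assms[OF s s] by (auto simp: matching_def)
  then show "s \<in> closure_rel X Y R"
    using s xy by (auto simp: closure_rel_def intro!: exI[of _ x] exI[of _ y])
qed

text \<open>This gives universality: an arbitrary closed \<open>E \<subseteq> X \<times> K\<close> enters through its distance function.\<close>

lemma generic_embedding:
  assumes X: "polish_metric X" and Y: "polish_metric Y"
    and F: "lip_family X K S F" and G: "generic Y K S G"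
  obtains \<phi> where "isometric_embedding X Y \<phi>"
    "\<And>x k. x \<in> mspace X \<Longrightarrow> k \<in> S \<Longrightarrow> F x k = G (\<phi> x) k"
proof -
  obtain D where D: "countable D" "D \<subseteq> mspace X"
    "\<And>x e. x \<in> mspace X \<Longrightarrow> 0 < e \<Longrightarrow> \<exists>y\<in>D. mdist X x y < e"
    by (rule polish_dense[OF X]) (rule that)
  obtain R where R: "\<And>s t. s \<in> R \<Longrightarrow> t \<in> R \<Longrightarrow> matching X Y S F G s t" "D \<subseteq> Domain R"
  proof (rule matching_chain[OF F G, of "{}" D "{}"])
    fix R
    assume "\<And>s t. s \<in> R \<Longrightarrow> t \<in> R \<Longrightarrow> matching X Y S F G s t" "D \<subseteq> Domain R"
    then show thesis by (rule that)
  qed (use D(1,2) in simp_all)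
  have "\<exists>y. (x, y) \<in> closure_rel X Y R" if "x \<in> mspace X" for x
    using closure_rel_total[OF Y R(1) _ that] D(3)[OF that] R(2) by (metis subsetD)
  then obtain \<phi> where \<phi>: "\<And>x. x \<in> mspace X \<Longrightarrow> (x, \<phi> x) \<in> closure_rel X Y R" by metis
  have m: "matching X Y S F G (x, \<phi> x) (x', \<phi> x')" if "x \<in> mspace X" "x' \<in> mspace X" for x x'
    using matching_closure[OF F generic_lip[OF G] R(1) \<phi>[OF that(1)] \<phi>[OF that(2)]] .
  show thesis
  proof (rule that[of \<phi>])
    show "isometric_embedding X Y \<phi>"
      using m unfolding isometric_embedding_def matching_def by auto
    show "F x k = G (\<phi> x) k" if "x \<in> mspace X" "k \<in> S" for x k
      using m[of x x] that unfolding matching_def by auto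
  qed
qed

text \<open>
  Going back and forth, the isometry is onto.  The given \<open>p\<close> is the partial isometry to be extended
  for ultrahomogeneity, and is empty for uniqueness.
\<close>

lemma generic_isometry:
  assumes X: "polish_metric X" and Y: "polish_metric Y"
    and F: "generic X K S F" and G: "generic Y K S G"
    and p: "finite p" "\<forall>s\<in>p. \<forall>t\<in>p. matching X Y S F G s t"
  obtains \<phi> where "\<phi> ` mspace X = mspace Y"
    "\<And>x x'. x \<in> mspace X \<Longrightarrow> x' \<in> mspace X \<Longrightarrow> mdist Y (\<phi> x) (\<phi> x') = mdist X x x'"
    "\<And>x k. x \<in> mspace X \<Longrightarrow> k \<in> S \<Longrightarrow> F x k = G (\<phi> x) k"
    "\<And>x y. (x, y) \<in> p \<Longrightarrow> \<phi> x = y"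
proof -
  note lF = generic_lip[OF F] and lG = generic_lip[OF G]
  obtain D where D: "countable D" "D \<subseteq> mspace X"
    "\<And>x e. x \<in> mspace X \<Longrightarrow> 0 < e \<Longrightarrow> \<exists>y\<in>D. mdist X x y < e"
    by (rule polish_dense[OF X]) (rule that)
  obtain E where E: "countable E" "E \<subseteq> mspace Y"
    "\<And>x e. x \<in> mspace Y \<Longrightarrow> 0 < e \<Longrightarrow> \<exists>y\<in>E. mdist Y x y < e"
    by (rule polish_dense[OF Y]) (rule that)
  obtain R where R: "p \<subseteq> R" "\<And>s t. s \<in> R \<Longrightarrow> t \<in> R \<Longrightarrow> matching X Y S F G s t"
    "D \<subseteq> Domain R" "E \<subseteq> Range R"
    by (rule matching_chain[OF lF G p D(1,2) E(1,2) F]) (rule that)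
  have "\<exists>y. (x, y) \<in> closure_rel X Y R" if "x \<in> mspace X" for x
    using closure_rel_total[OF Y R(2) _ that] D(3)[OF that] R(3) by (metis subsetD)
  then obtain \<phi> where \<phi>: "\<And>x. x \<in> mspace X \<Longrightarrow> (x, \<phi> x) \<in> closure_rel X Y R" by metis
  have m: "matching X Y S F G s t" if "s \<in> closure_rel X Y R" "t \<in> closure_rel X Y R" for s t
    using matching_closure[OF lF lG R(2) that] .
  have functional: "\<phi> x = y" if "(x, y) \<in> closure_rel X Y R" for x y
  proof -
    have x: "x \<in> mspace X" and y: "y \<in> mspace Y"
      using m[OF that that] by (simp_all add: matching_def)
    have "mdist Y (\<phi> x) y = mdist X x x" "\<phi> x \<in> mspace Y"
      using m[OF \<phi>[OF x] that] by (simp_all add: matching_def)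
    then show ?thesis using x y by simp
  qed
  show thesis
  proof (rule that[of \<phi>])
    show "mdist Y (\<phi> x) (\<phi> x') = mdist X x x'" if "x \<in> mspace X" "x' \<in> mspace X" for x x'
      using m[OF \<phi>[OF that(1)] \<phi>[OF that(2)]] by (simp add: matching_def)
    show "F x k = G (\<phi> x) k" if "x \<in> mspace X" "k \<in> S" for x k
      using m[OF \<phi>[OF that(1)] \<phi>[OF that(1)]] that by (simp add: matching_def)
    show "\<phi> x = y" if "(x, y) \<in> p" for x y
      using functional subset_closure_rel[of R, OF R(2)] R(1) that by blast
    show "\<phi> ` mspace X = mspace Y"
    proof (intro equalityI subsetI)
      fix y assume "y \<in> \<phi> ` mspace X"
      then show "y \<in> mspace Y" using m \<phi> by (fastforce simp: matching_def)
    next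
      fix y assume y: "y \<in> mspace Y"
      have "matching Y X S G F s t" if "s \<in> prod.swap ` R" "t \<in> prod.swap ` R" for s t
        using that R(2) by (auto simp: matching_swap simp del: swap_simp)
      moreover have "\<exists>b\<in>Domain (prod.swap ` R). mdist Y y b < e" if "0 < e" for e
        using E(3)[OF y that] R(4) by force
      ultimately obtain x where "(y, x) \<in> closure_rel Y X (prod.swap ` R)"
        using closure_rel_total[OF X, of "prod.swap ` R" Y S G F y] y by blast
      then have x: "(x, y) \<in> closure_rel X Y R" by (auto simp: closure_rel_swap)
      then have "x \<in> mspace X" using m[OF x x] by (simp add: matching_def)
      then show "y \<in> \<phi> ` mspace X" using functional[OF x] by blast
    qed
  qed
qed

section \<open>Profiles on a compact space\<close>

lemma compact_finite_net:
  assumes "compact_space (mtopology_of K)" "0 < e"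
  obtains N where "finite N" "N \<subseteq> mspace K" "\<And>k. k \<in> mspace K \<Longrightarrow> \<exists>s\<in>N. mdist K s k < e"
proof -
  interpret K: Metric_space "mspace K" "mdist K" by simp
  have "K.mtotally_bounded (mspace K)"
    using assms(1) unfolding mtopology_of_def K.compact_space_eq_mcomplete_mtotally_bounded ..
  then obtain N where N: "finite N" "N \<subseteq> mspace K" "mspace K \<subseteq> (\<Union>x\<in>N. K.mball x e)"
    using assms(2) unfolding K.mtotally_bounded_def by metis
  show thesis
  proof (rule that[OF N(1,2)])
    fix k assume "k \<in> mspace K"
    then have "k \<in> (\<Union>x\<in>N. K.mball x e)" using N(3) by (rule subsetD[rotated])
    then show "\<exists>s\<in>N. mdist K s k < e" by (auto simp: K.in_mball)
  qed
qed

lemma compact_bounded: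
  assumes "compact_space (mtopology_of K)"
  obtains B where "\<And>k l. k \<in> mspace K \<Longrightarrow> l \<in> mspace K \<Longrightarrow> mdist K k l \<le> B"
proof -
  interpret K: Metric_space "mspace K" "mdist K" by simp
  have "K.mtotally_bounded (mspace K)"
    using assms unfolding mtopology_of_def K.compact_space_eq_mcomplete_mtotally_bounded ..
  then have "K.mbounded (mspace K)" by (rule K.mtotally_bounded_imp_mbounded)
  then obtain B where "\<forall>k\<in>mspace K. \<forall>l\<in>mspace K. mdist K k l \<le> B"
    unfolding K.mbounded_alt by (elim conjE exE)
  then show thesis by (intro that[of B]) simp
qed

text \<open>
  The profiles on a compact space are separable for the supremum distance: a profile is
  approximated by the envelope of slightly larger rational values on a finite net.  This is the main
  use of the compactness of \<open>K\<close>.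
\<close>

lemma profiles_separable:
  assumes K: "compact_space (mtopology_of K)"
  obtains Q where "countable Q" "\<And>h. h \<in> Q \<Longrightarrow> profile K (mspace K) h"
    "\<And>g e. profile K (mspace K) g \<Longrightarrow> 0 < e \<Longrightarrow> \<exists>h\<in>Q. \<forall>k\<in>mspace K. \<bar>h k - g k\<bar> \<le> e"
proof -
  have "\<forall>n. \<exists>N. finite N \<and> N \<subseteq> mspace K \<and>
      (\<forall>k\<in>mspace K. \<exists>s\<in>N. mdist K s k < inverse (real (Suc n)))"
  proof
    fix n
    obtain N where "finite N" "N \<subseteq> mspace K"
      "\<And>k. k \<in> mspace K \<Longrightarrow> \<exists>s\<in>N. mdist K s k < inverse (real (Suc n))"
      using compact_finite_net[OF K, of "inverse (real (Suc n))"] by auto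
    then show "\<exists>N. finite N \<and> N \<subseteq> mspace K \<and>
      (\<forall>k\<in>mspace K. \<exists>s\<in>N. mdist K s k < inverse (real (Suc n)))" by blast
  qed
  then obtain N where N: "\<And>n. finite (N n)" "\<And>n. N n \<subseteq> mspace K"
    "\<And>n k. k \<in> mspace K \<Longrightarrow> \<exists>s\<in>N n. mdist K s k < inverse (real (Suc n))"
    by metis
  define W where "W = {T. finite T \<and> T \<subseteq> (\<Union>n. N n) \<times> {r \<in> \<rat>. 0 \<le> (r :: real)}} - {{}}"
  define Q where "Q = insert (\<lambda>_. 0) (envelope K ` W)"
  have "countable ((\<Union>n. N n) \<times> {r \<in> \<rat>. 0 \<le> (r::real)})"
    using N(1) countable_rat
    by (intro countable_SIGMA countable_UN) (auto intro: countable_finite countable_subset)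
  then have "countable Q"
    unfolding Q_def W_def by (intro countable_insert countable_image countable_Diff countable_Collect_finite_subset)
  moreover have "profile K (mspace K) h" if h: "h \<in> Q" for h
  proof (cases "h = (\<lambda>_. 0)")
    case True
    then show ?thesis by (simp add: profile_def)
  next
    case False
    then obtain T where T: "T \<in> W" "h = envelope K T" using h by (auto simp: Q_def)
    have "T \<noteq> {}" "T \<subseteq> (\<Union>n. N n) \<times> {r \<in> \<rat>. 0 \<le> r}" using T(1) by (auto simp: W_def)
    then have T': "T \<noteq> {}" "\<And>s r. (s, r) \<in> T \<Longrightarrow> s \<in> mspace K \<and> 0 \<le> r"
      using N(2) by blast+
    show ?thesis
      unfolding profile_def T(2)
    proof (intro ballI conjI)
      show "0 \<le> envelope K T k" for k
        using T' by (intro envelope_ge add_nonneg_nonneg) auto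
      show "envelope K T k \<le> envelope K T l + mdist K k l" if "k \<in> mspace K" "l \<in> mspace K" for k l
        by (rule envelope_lipschitz[OF T' that])
    qed
  qed
  moreover have "\<exists>h\<in>Q. \<forall>k\<in>mspace K. \<bar>h k - g k\<bar> \<le> e"
    if g: "profile K (mspace K) g" and e: "0 < e" for g e
  proof (cases "mspace K = {}")
    case True
    then show ?thesis by (auto simp: Q_def)
  next
    case False
    have e3: "0 < e / 3" using e by simp
    then obtain n where n: "inverse (real (Suc n)) < e / 3" using reals_Archimedean by blast
    have "\<exists>r\<in>\<rat>. g s < r \<and> r < g s + e / 3" for s
      using Rats_dense_in_real[of "g s" "g s + e / 3"] e3 by simp
    then obtain v where v: "\<And>s. v s \<in> \<rat>" "\<And>s. g s < v s" "\<And>s. v s < g s + e / 3" by metis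
    define T where "T = (\<lambda>s. (s, v s)) ` N n"
    have g0: "0 \<le> g s" if "s \<in> mspace K" for s using profile_nonneg[OF g that] .
    have v0: "0 \<le> v s" if "s \<in> N n" for s
      using g0[of s] v(2)[of s] that N(2) by fastforce
    have Tne: "T \<noteq> {}" using False N(3)[of _ n] by (auto simp: T_def)
    have T: "T \<in> W"
      unfolding W_def using N(1) v(1) v0 Tne by (auto simp: T_def)
    have "\<bar>envelope K T k - g k\<bar> \<le> e" if k: "k \<in> mspace K" for k
    proof -
      have "g k \<le> envelope K T k"
      proof (rule envelope_ge[OF Tne])
        fix s r assume "(s, r) \<in> T"
        then have s: "s \<in> mspace K" "r = v s" using N(2) by (auto simp: T_def)
        then have "g k \<le> g s + mdist K k s" using profileD[OF g k] by blast
        then show "g k \<le> r + mdist K s k" using v(2)[of s] s by (simp add: mdist_commute)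
      qed
      moreover have "envelope K T k \<le> g k + e"
      proof -
        obtain s where s: "s \<in> N n" "mdist K s k < inverse (real (Suc n))" using N(3) k by blast
        have "envelope K T k \<le> v s + mdist K s k"
          using v0 s by (intro envelope_le) (auto simp: T_def)
        moreover have "g s \<le> g k + mdist K s k"
          using profileD[OF g, of s k] k s N(2) by blast
        ultimately show ?thesis using v(3)[of s] s(2) n by linarith
      qed
      ultimately show ?thesis using e by linarith
    qed
    then show ?thesis using T by (auto simp: Q_def)
  qed
  ultimately show thesis by (rule that)
qed

section \<open>A generic family on the Urysohn space\<close>

text \<open>
  If \<open>f\<close> vanishes at some \<open>c\<close>, then the new point would coincide with \<open>c\<close>; only otherwise do \<open>A\<close>
  and the new point form a metric space, to which the extension property applies.
\<close>

lemma urysohn_one_point: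
  assumes U: "urysohn_space U" and A: "finite A" "A \<subseteq> mspace U" and kat: "katetov U A f"
  obtains z where "z \<in> mspace U" "\<And>a. a \<in> A \<Longrightarrow> mdist U z a = f a"
proof (cases "\<exists>c\<in>A. f c = 0")
  case True
  then obtain c where c: "c \<in> A" "f c = 0" by blast
  have "mdist U c a = f a" if "a \<in> A" for a
    using katetovD(2)[OF kat c(1) that] katetovD(1)[OF kat that c(1)] c(2)
    by (simp add: mdist_commute)
  then show thesis using c A by (intro that[of c]) auto
next
  case False
  have f: "0 < f a" if "a \<in> A" for a
    using False katetov_nonneg[OF kat that] that by (metis less_eq_real_def)
  define \<delta> where "\<delta> p q = (case p of
      Inl a \<Rightarrow> (case q of Inl b \<Rightarrow> mdist U a b | Inr _ \<Rightarrow> \<bar>f a\<bar>)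
    | Inr _ \<Rightarrow> (case q of Inl b \<Rightarrow> \<bar>f b\<bar> | Inr _ \<Rightarrow> 0))" for p q :: "'a + nat"
  have M: "Metric_space (insert (Inr 0) (Inl ` A)) \<delta>"
  proof
    show "0 \<le> \<delta> p q" for p q by (auto simp: \<delta>_def split: sum.splits)
    show "\<delta> p q = \<delta> q p" for p q by (auto simp: \<delta>_def mdist_commute split: sum.splits)
    show "\<delta> p q = 0 \<longleftrightarrow> p = q" if "p \<in> insert (Inr 0) (Inl ` A)" "q \<in> insert (Inr 0) (Inl ` A)" for p q
      using that A False by (auto simp: \<delta>_def subset_iff)
    show "\<delta> p r \<le> \<delta> p q + \<delta> q r"
      if "p \<in> insert (Inr 0) (Inl ` A)" "q \<in> insert (Inr 0) (Inl ` A)"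
        "r \<in> insert (Inr 0) (Inl ` A)" for p q r
    proof -
      have \<delta>_simps: "\<delta> (Inl a) (Inl b) = mdist U a b" "\<delta> (Inr m) (Inr n) = 0" for a b m n
        by (simp_all add: \<delta>_def)
      have \<delta>_new: "\<delta> (Inl a) (Inr n) = f a" "\<delta> (Inr n) (Inl a) = f a" if "a \<in> A" for a n
        using f[OF that] by (simp_all add: \<delta>_def)
      have t: "mdist U a c \<le> mdist U a b + mdist U b c" if "a \<in> A" "b \<in> A" "c \<in> A" for a b c
        using that A by (intro mdist_triangle) auto
      have k: "f a \<le> f b + mdist U b a" "f a \<le> mdist U a b + f b" "mdist U a b \<le> f a + f b"
        if "a \<in> A" "b \<in> A" for a b
        using katetovD[OF kat that] by (simp_all add: mdist_commute add.commute)
      have k0: "0 \<le> f a + f a" if "a \<in> A" for a using f[OF that] by simp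
      from that show ?thesis
        by (elim insertE imageE; hypsubst; simp only: \<delta>_simps \<delta>_new)
          ((rule t k k0; assumption)+)
    qed
  qed
  let ?M = "metric (insert (Inr 0) (Inl ` A), \<delta>)"
  have mM: "mspace ?M = insert (Inr 0) (Inl ` A)" and dM: "mdist ?M = \<delta>"
    using Metric_space.mspace_metric[OF M] Metric_space.mdist_metric[OF M] by auto
  have "finite A \<and> A \<subseteq> mspace U \<and> finite (mspace ?M) \<and> Inl ` A \<subseteq> mspace ?M \<and>
      (\<forall>x\<in>A. \<forall>y\<in>A. mdist ?M (Inl x) (Inl y) = mdist U x y)"
    unfolding mM dM using A by (auto simp: \<delta>_def)
  then have "\<exists>i. isometric_embedding ?M U i \<and> (\<forall>x\<in>A. i (Inl x) = x)"
    by (rule U[unfolded urysohn_space_def, THEN conjunct2, rule_format])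
  then obtain i where i: "isometric_embedding ?M U i" "\<forall>x\<in>A. i (Inl x) = x"
    by blast
  show thesis
  proof (rule that[of "i (Inr 0)"])
    show "i (Inr 0) \<in> mspace U" using i(1) unfolding isometric_embedding_def mM by blast
    fix a assume a: "a \<in> A"
    then have "mdist U (i (Inr 0)) (i (Inl a)) = \<delta> (Inr 0) (Inl a)"
      using i(1) unfolding isometric_embedding_def mM dM by blast
    then show "mdist U (i (Inr 0)) a = f a" using i(2) a f by (simp add: \<delta>_def abs_of_pos)
  qed
qed

text \<open>
  A set of pairs \<open>(x, g)\<close>, all of which are related in this way, is a partial Lipschitz family
  that assigns the profile \<open>g\<close> to \<open>x\<close>.  For equal points the condition forces equal profiles.
\<close>

definition lip_compatible ::
  "'u metric \<Rightarrow> 'k metric \<Rightarrow> 'u \<times> ('k \<Rightarrow> real) \<Rightarrow> 'u \<times> ('k \<Rightarrow> real) \<Rightarrow> bool" where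
  "lip_compatible U K p q \<longleftrightarrow> fst p \<in> mspace U \<and> profile K (mspace K) (snd p) \<and>
     (\<forall>k\<in>mspace K. snd p k \<le> snd q k + mdist U (fst p) (fst q))"

text \<open>
  McShane's formula serves twice: to put a new point into the domain of a finite partial family,
  and to extend the final family from a dense set to all of \<open>U\<close>.
\<close>

definition mcshane :: "'u metric \<Rightarrow> ('u \<times> ('k \<Rightarrow> real)) set \<Rightarrow> 'u \<Rightarrow> 'k \<Rightarrow> real" where
  "mcshane U R x k = envelope U ((\<lambda>(y, g). (y, g k)) ` R) x"

lemma mcshane_lip_family:
  assumes R: "\<And>s t. s \<in> R \<Longrightarrow> t \<in> R \<Longrightarrow> lip_compatible U K s t" and ne: "R \<noteq> {}"
  shows "lip_family U K (mspace K) (mcshane U R)"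
proof -
  have P: "y \<in> mspace U" "\<And>k. k \<in> mspace K \<Longrightarrow> 0 \<le> g k"
    "\<And>k l. k \<in> mspace K \<Longrightarrow> l \<in> mspace K \<Longrightarrow> g k \<le> g l + mdist K k l" if "(y, g) \<in> R" for y g
    using R[OF that that] unfolding lip_compatible_def profile_def by auto
  have le: "mcshane U R x k \<le> g k + mdist U y x" if "(y, g) \<in> R" "k \<in> mspace K" for x y g k
    unfolding mcshane_def using P that by (intro envelope_le) auto
  have ge: "c \<le> mcshane U R x k" if "\<And>y g. (y, g) \<in> R \<Longrightarrow> c \<le> g k + mdist U y x" for c x k
    unfolding mcshane_def using ne that by (intro envelope_ge) auto
  show ?thesis
    unfolding lip_family_def profile_def
  proof (intro conjI ballI)
    fix x k l assume x: "x \<in> mspace U" and k: "k \<in> mspace K" and l: "l \<in> mspace K"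
    show "0 \<le> mcshane U R x k" using P k by (intro ge add_nonneg_nonneg) auto
    have "mcshane U R x k - mdist K k l \<le> mcshane U R x l"
    proof (rule ge)
      fix y g assume yg: "(y, g) \<in> R"
      show "mcshane U R x k - mdist K k l \<le> g l + mdist U y x"
        using le[OF yg k, of x] P(3)[OF yg k l] by linarith
    qed
    then show "mcshane U R x k \<le> mcshane U R x l + mdist K k l" by linarith
  next
    fix x y k assume x: "x \<in> mspace U" and y: "y \<in> mspace U" and k: "k \<in> mspace K"
    show "mcshane U R x k \<le> mcshane U R y k + mdist U x y"
      unfolding mcshane_def using ne P k by (intro envelope_lipschitz x y) auto
  qed
qed

lemma mcshane_extends:
  assumes R: "\<And>s t. s \<in> R \<Longrightarrow> t \<in> R \<Longrightarrow> lip_compatible U K s t"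
    and x: "(x, g) \<in> R" and k: "k \<in> mspace K"
  shows "mcshane U R x k = g k"
proof (rule antisym)
  have P: "y \<in> mspace U \<and> 0 \<le> h k \<and> g k \<le> h k + mdist U x y" if "(y, h) \<in> R" for y h
    using R[OF that that] R[OF x that] k unfolding lip_compatible_def profile_def by auto
  have "mcshane U R x k \<le> g k + mdist U x x"
    unfolding mcshane_def using P x by (intro envelope_le) auto
  then show "mcshane U R x k \<le> g k" using P[OF x] by simp
  show "g k \<le> mcshane U R x k"
    unfolding mcshane_def using P x by (intro envelope_ge) (auto simp: mdist_commute)
qed

lemma lip_compatible_add_point:
  assumes p: "finite p" "\<forall>s\<in>p. \<forall>t\<in>p. lip_compatible U K s t" and u: "u \<in> mspace U"
  obtains g where "\<forall>s\<in>insert (u, g) p. \<forall>t\<in>insert (u, g) p. lip_compatible U K s t"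
proof (cases "p = {}")
  case True
  then show thesis
    using u by (intro that[of "\<lambda>_. 0"]) (auto simp: lip_compatible_def profile_def)
next
  case False
  have lip: "lip_family U K (mspace K) (mcshane U p)"
    using mcshane_lip_family[of p U K] p False by blast
  have eq: "mcshane U p y k = g k" if "(y, g) \<in> p" "k \<in> mspace K" for y g k
    using mcshane_extends[of p U K y g k] p that by blast
  have P: "y \<in> mspace U" if "(y, g) \<in> p" for y g
    using p that unfolding lip_compatible_def by fastforce
  have "mcshane U p u k \<le> g k + mdist U u y" "g k \<le> mcshane U p u k + mdist U y u"
    if "(y, g) \<in> p" "k \<in> mspace K" for y g k
    using lip_familyD[OF lip u P[OF that(1)] that(2)] lip_familyD[OF lip P[OF that(1)] u that(2)]
      eq[OF that] by simp_all
  moreover have "profile K (mspace K) (mcshane U p u)"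
    using lip u by (simp add: lip_family_def)
  ultimately show thesis
    using p u by (intro that[of "mcshane U p u"]) (auto simp: lip_compatible_def)
qed

lemma lip_compatible_add_points:
  assumes "finite B" "B \<subseteq> mspace U" "finite p" "\<forall>s\<in>p. \<forall>t\<in>p. lip_compatible U K s t"
  shows "\<exists>q. p \<subseteq> q \<and> finite q \<and> (\<forall>s\<in>q. \<forall>t\<in>q. lip_compatible U K s t) \<and> B \<subseteq> Domain q"
  using assms(1,2)
proof (induction B)
  case empty
  then show ?case using assms by (intro exI[of _ p]) auto
next
  case (insert b B)
  then obtain q where q: "p \<subseteq> q" "finite q" "\<forall>s\<in>q. \<forall>t\<in>q. lip_compatible U K s t"
    "B \<subseteq> Domain q" by auto
  obtain g where "\<forall>s\<in>insert (b, g) q. \<forall>t\<in>insert (b, g) q. lip_compatible U K s t"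
    using lip_compatible_add_point[OF q(2,3)] insert.prems by blast
  then show ?case using q by (intro exI[of _ "insert (b, g) q"]) auto
qed

text \<open>
  The requirements of the construction.  A task \<open>(T, h)\<close> asks for a point with profile \<open>h\<close> whose
  distances to the points in \<open>T\<close> are given by the envelope of \<open>T\<close>; the envelope rather than the
  given numbers because the latter need not be Lipschitz, being rational approximations.  The
  task lapses if the profiles already chosen on \<open>T\<close> rule \<open>h\<close> out.
\<close>

definition task_done ::
  "'u metric \<Rightarrow> 'k metric \<Rightarrow> ('u \<times> real) set \<Rightarrow> ('k \<Rightarrow> real) \<Rightarrow> ('u \<times> ('k \<Rightarrow> real)) set \<Rightarrow> bool" where
  "task_done U K T h p \<longleftrightarrow> fst ` T \<subseteq> Domain p \<and>
     ((\<forall>a r g. (a, r) \<in> T \<longrightarrow> (a, g) \<in> p \<longrightarrow> (\<forall>k\<in>mspace K. \<bar>g k - h k\<bar> \<le> r)) \<longrightarrow>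
      (\<exists>z. (z, h) \<in> p \<and> (\<forall>(a, r)\<in>T. mdist U z a = envelope U T a)))"

text \<open>
  The distances to all points treated so far are prescribed by the same envelope.  Any such point
  \<open>y\<close> is reached through some \<open>a\<close> in the task, which keeps the profile \<open>h\<close> compatible with the one
  of \<open>y\<close> by the triangle inequality.
\<close>

lemma task_can_be_done:
  assumes U: "urysohn_space U"
    and p: "finite p" "\<forall>s\<in>p. \<forall>t\<in>p. lip_compatible U K s t"
    and T: "finite T" "T \<noteq> {}" "\<And>a r. (a, r) \<in> T \<Longrightarrow> a \<in> mspace U"
      "\<And>a b r s. (a, r) \<in> T \<Longrightarrow> (b, s) \<in> T \<Longrightarrow> mdist U a b \<le> r + s"
    and h: "profile K (mspace K) h"
  shows "\<exists>q. p \<subseteq> q \<and> finite q \<and> (\<forall>s\<in>q. \<forall>t\<in>q. lip_compatible U K s t) \<and> task_done U K T h q"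
proof -
  obtain q where q: "p \<subseteq> q" "finite q" "\<forall>s\<in>q. \<forall>t\<in>q. lip_compatible U K s t"
    "fst ` T \<subseteq> Domain q"
  proof -
    have "finite (fst ` T)" "fst ` T \<subseteq> mspace U" using T(1,3) by auto
    then show thesis using lip_compatible_add_points[OF _ _ p, of "fst ` T"] that by metis
  qed
  show ?thesis
  proof (cases "\<forall>a r g. (a, r) \<in> T \<longrightarrow> (a, g) \<in> q \<longrightarrow> (\<forall>k\<in>mspace K. \<bar>g k - h k\<bar> \<le> r)")
    case False
    then have "task_done U K T h q" using q(4) unfolding task_done_def
      by (intro conjI impI) (assumption, erule notE[OF False])
    with q show ?thesis by blast
  next
    case True
    have P: "y \<in> mspace U" "profile K (mspace K) g" if "(y, g) \<in> q" for y g
    proof -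
      have "lip_compatible U K (y, g) (y, g)" using q(3) that by blast
      then show "y \<in> mspace U" "profile K (mspace K) g" by (simp_all add: lip_compatible_def)
    qed
    have L: "g k \<le> g' k + mdist U y y'" if "(y, g) \<in> q" "(y', g') \<in> q" "k \<in> mspace K" for y g y' g' k
    proof -
      have "lip_compatible U K (y, g) (y', g')" using q(3) that(1,2) by blast
      then show ?thesis using that(3) by (simp add: lip_compatible_def)
    qed
    have T0: "a \<in> mspace U \<and> 0 \<le> r" if "(a, r) \<in> T" for a r
      using T(3)[OF that] T(4)[OF that that] by simp
    have kat: "katetov U (Domain q) (envelope U T)"
      unfolding katetov_def
    proof (intro ballI conjI)
      fix x y assume "x \<in> Domain q" "y \<in> Domain q"
      then have x: "x \<in> mspace U" and y: "y \<in> mspace U" using P by blast+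
      show "envelope U T x \<le> envelope U T y + mdist U x y"
        by (rule envelope_lipschitz[OF T(2) T0 x y])
      obtain a r where a: "(a, r) \<in> T" "envelope U T x = r + mdist U a x"
        using envelope_attained[OF T(1,2), of U x] by blast
      obtain b s where b: "(b, s) \<in> T" "envelope U T y = s + mdist U b y"
        using envelope_attained[OF T(1,2), of U y] by blast
      have "mdist U x y \<le> mdist U x a + mdist U a y" "mdist U a y \<le> mdist U a b + mdist U b y"
        using x y T(3) a b by (auto intro!: mdist_triangle)
      then show "mdist U x y \<le> envelope U T x + envelope U T y"
        using T(4)[OF a(1) b(1)] a b by (simp add: mdist_commute)
    qed
    have "finite (Domain q)" "Domain q \<subseteq> mspace U" using q(2) P(1) by (auto simp: finite_Domain)
    then obtain z where z: "z \<in> mspace U"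
      "\<And>x. x \<in> Domain q \<Longrightarrow> mdist U z x = envelope U T x"
      by (rule urysohn_one_point[OF U _ _ kat]) (rule that)
    have new: "h k \<le> g k + mdist U z y" "g k \<le> h k + mdist U y z"
      if yg: "(y, g) \<in> q" and k: "k \<in> mspace K" for y g k
    proof -
      obtain a r where a: "(a, r) \<in> T" "envelope U T y = r + mdist U a y"
        using envelope_attained[OF T(1,2), of U y] by blast
      then obtain g' where g': "(a, g') \<in> q" using q(4) by force
      have "\<bar>g' k - h k\<bar> \<le> r" using True a g' k by blast
      moreover have "mdist U z y = r + mdist U a y" using z(2)[of y] yg a(2) by auto
      ultimately show "h k \<le> g k + mdist U z y" "g k \<le> h k + mdist U y z"
        using L[OF yg g' k] L[OF g' yg k] by (auto simp: mdist_commute)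
    qed
    have "lip_compatible U K (z, h) (z, h)" using z(1) h by (simp add: lip_compatible_def)
    moreover have "lip_compatible U K (y, g) (z, h) \<and> lip_compatible U K (z, h) (y, g)"
      if "(y, g) \<in> q" for y g
      using new[OF that] P[OF that] z(1) h by (simp add: lip_compatible_def)
    ultimately have compat: "\<forall>s\<in>insert (z, h) q. \<forall>t\<in>insert (z, h) q. lip_compatible U K s t"
      using q(3) unfolding pairwise_insert_iff by auto
    have "mdist U z a = envelope U T a" if "(a, r) \<in> T" for a r
    proof -
      have "a \<in> Domain q" using q(4) that by force
      then show ?thesis by (rule z(2))
    qed
    then have "\<exists>z'. (z', h) \<in> insert (z, h) q \<and> (\<forall>(a, r)\<in>T. mdist U z' a = envelope U T a)"
      by (intro exI[of _ z]) auto
    moreover have "fst ` T \<subseteq> Domain (insert (z, h) q)" using q(4) by auto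
    ultimately have "task_done U K T h (insert (z, h) q)" by (simp add: task_done_def)
    then show ?thesis using q(1,2) compat by (intro exI[of _ "insert (z, h) q"]) auto
  qed
qed

text \<open>
  What countably many tasks can achieve.  The set \<open>A\<close> is nonempty because a task fixes the new
  point by its distances to given ones.
\<close>

definition nearly_generic :: "'u metric \<Rightarrow> 'k metric \<Rightarrow> ('u \<Rightarrow> 'k \<Rightarrow> real) \<Rightarrow> bool" where
  "nearly_generic U K F \<longleftrightarrow>
     (\<forall>A f g e. finite A \<and> A \<noteq> {} \<and> A \<subseteq> mspace U \<and> katetov U A f \<and> profile K (mspace K) g \<and>
        (\<forall>a\<in>A. \<forall>k\<in>mspace K. \<bar>F a k - g k\<bar> \<le> f a) \<and> 0 < e \<longrightarrow>
        (\<exists>z\<in>mspace U. (\<forall>a\<in>A. \<bar>mdist U z a - f a\<bar> \<le> e) \<and> (\<forall>k\<in>mspace K. \<bar>F z k - g k\<bar> \<le> e)))"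

text \<open>
  Only countably many tasks are needed: those with points in a countable dense set \<open>D\<close>, rational
  numbers, and profiles in a countable dense set \<open>Q\<close>.  A given extension of a finite set \<open>A\<close> is
  replaced by a task nearby, whose numbers are chosen slightly larger than the given distances so
  that the profile stays admissible.
\<close>

lemma nearly_generic_exists:
  assumes U: "urysohn_space U" and K: "compact_space (mtopology_of K)"
  obtains F where "lip_family U K (mspace K) F" "nearly_generic U K F"
proof -
  have polish: "polish_metric U" using U by (simp add: urysohn_space_def)
  obtain D where D: "countable D" "D \<subseteq> mspace U"
    "\<And>x e. x \<in> mspace U \<Longrightarrow> 0 < e \<Longrightarrow> \<exists>y\<in>D. mdist U x y < e"
    by (rule polish_dense[OF polish]) (rule that)
  obtain Q where Q: "countable Q" "\<And>h. h \<in> Q \<Longrightarrow> profile K (mspace K) h"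
    "\<And>g e. profile K (mspace K) g \<Longrightarrow> 0 < e \<Longrightarrow> \<exists>h\<in>Q. \<forall>k\<in>mspace K. \<bar>h k - g k\<bar> \<le> e"
    by (rule profiles_separable[OF K]) (rule that)
  define W where "W = {T \<in> {T. finite T \<and> T \<subseteq> D \<times> \<rat>}.
    T \<noteq> {} \<and> (\<forall>(a, r)\<in>T. \<forall>(b, s)\<in>T. mdist U a b \<le> r + s)}"
  have "countable {T. finite T \<and> T \<subseteq> D \<times> (\<rat> :: real set)}"
    using D(1) countable_rat by (intro countable_Collect_finite_subset countable_SIGMA)
  then have W: "countable W" unfolding W_def by (rule countable_subset[rotated]) blast
  obtain R where R: "\<And>s t. s \<in> R \<Longrightarrow> t \<in> R \<Longrightarrow> lip_compatible U K s t"
    and tasks_done: "\<And>T h. T \<in> W \<Longrightarrow> h \<in> Q \<Longrightarrow> \<exists>p\<subseteq>R. task_done U K T h p"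
  proof (rule Rasiowa_Sikorski[of "W \<times> Q" "{}" "lip_compatible U K" "\<lambda>(T, h). task_done U K T h"])
    show "countable (W \<times> Q)" using W Q(1) by simp
    fix p i
    assume p: "finite p" "\<forall>s\<in>p. \<forall>t\<in>p. lip_compatible U K s t" and "i \<in> W \<times> Q"
    then obtain T h where T: "T \<in> W" and h: "h \<in> Q" and i: "i = (T, h)" by blast
    show "\<exists>q. p \<subseteq> q \<and> finite q \<and> (\<forall>s\<in>q. \<forall>t\<in>q. lip_compatible U K s t) \<and>
        (case i of (T, h) \<Rightarrow> task_done U K T h) q"
      unfolding i case_prod_conv using T D(2)
      by (intro task_can_be_done[OF U p _ _ _ _ Q(2)[OF h]]) (auto simp: W_def)
  next
    fix R
    assume R: "\<And>s t. s \<in> R \<Longrightarrow> t \<in> R \<Longrightarrow> lip_compatible U K s t"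
      and req: "\<And>i. i \<in> W \<times> Q \<Longrightarrow> \<exists>p\<subseteq>R. (case i of (T, h) \<Rightarrow> task_done U K T h) p"
    show thesis
    proof (rule that[OF R])
      show "\<exists>p\<subseteq>R. task_done U K T h p" if "T \<in> W" "h \<in> Q" for T h
        using req[of "(T, h)"] that by simp
    qed
  qed auto
  obtain u where u: "u \<in> mspace U"
    by (rule urysohn_one_point[OF U, of "{}" "\<lambda>_. 0"]) (auto simp: katetov_def)
  then obtain u' where u': "u' \<in> D" using D(3)[OF u, of 1] by auto
  have "{(u', 0)} \<in> W" using u' D(2) by (auto simp: W_def)
  moreover obtain h0 where "h0 \<in> Q" using Q(3)[of "\<lambda>_. 0" 1] by (auto simp: profile_def)
  ultimately have "\<exists>p\<subseteq>R. task_done U K {(u', 0)} h0 p" by (rule tasks_done)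
  then have ne: "R \<noteq> {}" by (auto simp: task_done_def)
  define F where "F = mcshane U R"
  have lip: "lip_family U K (mspace K) F"
    unfolding F_def by (rule mcshane_lip_family[OF R ne])
  have F: "F y k = g k" if "(y, g) \<in> R" "k \<in> mspace K" for y g k
    unfolding F_def by (rule mcshane_extends[OF R that])
  have RU: "y \<in> mspace U" if "(y, g) \<in> R" for y g
    using R[OF that that] by (simp add: lip_compatible_def)
  have "nearly_generic U K F"
    unfolding nearly_generic_def
  proof (intro allI impI)
    fix A f g and e :: real
    assume "finite A \<and> A \<noteq> {} \<and> A \<subseteq> mspace U \<and> katetov U A f \<and> profile K (mspace K) g \<and>
      (\<forall>a\<in>A. \<forall>k\<in>mspace K. \<bar>F a k - g k\<bar> \<le> f a) \<and> 0 < e"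
    then have A: "finite A" "A \<noteq> {}" "A \<subseteq> mspace U" and kat: "katetov U A f"
      and g: "profile K (mspace K) g" and Fg: "\<And>a k. a \<in> A \<Longrightarrow> k \<in> mspace K \<Longrightarrow> \<bar>F a k - g k\<bar> \<le> f a"
      and e: "0 < e" by auto
    \<comment> \<open>The numbers \<open>r a\<close> exceed \<open>f a\<close> by at least \<open>2 * \<delta>\<close>, which absorbs moving from \<open>a\<close> to \<open>c a\<close>
      and from \<open>g\<close> to \<open>h\<close>, and by at most \<open>3 * \<delta>\<close>, which with \<open>d (a, c a) < \<delta>\<close> makes the error
      \<open>4 * \<delta>\<close>.\<close>
    define \<delta> where "\<delta> = e / 4"
    have \<delta>: "0 < \<delta>" using e by (simp add: \<delta>_def)
    obtain h where h: "h \<in> Q" "\<And>k. k \<in> mspace K \<Longrightarrow> \<bar>h k - g k\<bar> \<le> \<delta>" using Q(3)[OF g \<delta>] by blast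
    have "\<forall>a\<in>A. \<exists>y\<in>D. mdist U a y < \<delta>" using D(3) A(3) \<delta> by blast
    then obtain c where c: "\<And>a. a \<in> A \<Longrightarrow> c a \<in> D" "\<And>a. a \<in> A \<Longrightarrow> mdist U a (c a) < \<delta>" by metis
    have cU: "c a \<in> mspace U" if "a \<in> A" for a using c(1)[OF that] D(2) by blast
    have "\<exists>r\<in>\<rat>. f a + 2 * \<delta> < r \<and> r < f a + 3 * \<delta>" for a
      using Rats_dense_in_real[of "f a + 2 * \<delta>" "f a + 3 * \<delta>"] \<delta> by simp
    then obtain r where r: "\<And>a. r a \<in> \<rat>" "\<And>a. f a + 2 * \<delta> < r a" "\<And>a. r a < f a + 3 * \<delta>" by metis
    define T where "T = (\<lambda>a. (c a, r a)) ` A"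
    have cc: "\<bar>mdist U a b - mdist U (c a) (c b)\<bar> \<le> 2 * \<delta>" if "a \<in> A" "b \<in> A" for a b
    proof -
      have "\<bar>mdist U a b - mdist U (c a) (c b)\<bar> \<le> mdist U a (c a) + mdist U b (c b)"
        using that A(3) cU by (intro mdist_perturb) auto
      then show ?thesis using c(2)[OF that(1)] c(2)[OF that(2)] by linarith
    qed
    have katD: "f a \<le> f b + mdist U a b" "mdist U a b \<le> f a + f b" if "a \<in> A" "b \<in> A" for a b
      using katetovD[OF kat that] .
    have "mdist U (c a) (c b) \<le> r a + r b" if "a \<in> A" "b \<in> A" for a b
      using cc[OF that] katD(2)[OF that] r(2)[of a] r(2)[of b] \<delta> by linarith
    then have "T \<in> W" using A(1,2) c(1) r(1) by (auto simp: W_def T_def)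
    then obtain p where p: "p \<subseteq> R" "task_done U K T h p" using tasks_done h(1) by blast
    have "\<bar>g' k - h k\<bar> \<le> s" if ys: "(y, s) \<in> T" "(y, g') \<in> p" "k \<in> mspace K" for y s g' k
    proof -
      obtain a where a: "a \<in> A" "y = c a" "s = r a" using ys(1) by (auto simp: T_def)
      have "\<bar>F a k - F (c a) k\<bar> \<le> mdist U a (c a)"
        using lip_family_abs[OF lip, of a "c a" k] A(3) a(1) cU that(3) by auto
      moreover have "F (c a) k = g' k" using F[of y g' k] p(1) that a by auto
      ultimately show ?thesis
        using Fg[OF a(1) that(3)] h(2)[OF that(3)] c(2)[OF a(1)] r(2)[of a] a(3) by linarith
    qed
    then have "\<exists>z. (z, h) \<in> p \<and> (\<forall>(y, s)\<in>T. mdist U z y = envelope U T y)"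
      using p(2) by (simp add: task_done_def)
    then obtain z where z: "(z, h) \<in> p" "\<And>y s. (y, s) \<in> T \<Longrightarrow> mdist U z y = envelope U T y"
      by blast
    have zU: "z \<in> mspace U" using RU z(1) p(1) by blast
    have T0: "0 \<le> s" if "(y, s) \<in> T" for y s
    proof -
      obtain a where "a \<in> A" "s = r a" using \<open>(y, s) \<in> T\<close> by (auto simp: T_def)
      then show ?thesis using katetov_nonneg[OF kat, of a] r(2)[of a] \<delta> by linarith
    qed
    have "\<bar>mdist U z a - f a\<bar> \<le> e" if a: "a \<in> A" for a
    proof -
      have ca: "(c a, r a) \<in> T" using a by (auto simp: T_def)
      have "envelope U T (c a) \<le> r a + mdist U (c a) (c a)"
        using T0 ca by (intro envelope_le) auto
      moreover have "f a \<le> envelope U T (c a)"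
      proof (rule envelope_ge)
        show "T \<noteq> {}" using A by (simp add: T_def)
        fix y s assume "(y, s) \<in> T"
        then obtain b where b: "b \<in> A" "y = c b" "s = r b" by (auto simp: T_def)
        show "f a \<le> s + mdist U y (c a)"
          using katD(1)[OF a b(1)] cc[OF a b(1)] r(2)[of b] b(2,3) by (simp add: mdist_commute)
      qed
      moreover have "\<bar>mdist U z a - mdist U z (c a)\<bar> \<le> mdist U z z + mdist U a (c a)"
        using zU A(3) a cU by (intro mdist_perturb) auto
      ultimately show ?thesis
        using z(2)[OF ca] r(3)[of a] c(2)[OF a] cU[OF a] zU by (simp add: \<delta>_def abs_le_iff)
    qed
    moreover have "\<bar>F z k - g k\<bar> \<le> e" if "k \<in> mspace K" for k
      using F[of z h k] z(1) p(1) h(2)[OF that] that e by (auto simp: \<delta>_def)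
    ultimately show "\<exists>z\<in>mspace U. (\<forall>a\<in>A. \<bar>mdist U z a - f a\<bar> \<le> e) \<and> (\<forall>k\<in>mspace K. \<bar>F z k - g k\<bar> \<le> e)"
      using zU by blast
  qed
  with lip show thesis by (rule that)
qed

text \<open>
  Completeness removes the error.  If \<open>z\<close> realises the extension up to \<open>e\<close>, then the extension
  together with a distance \<open>e\<close> to \<open>z\<close> is again admissible on \<open>A \<union> {z}\<close>, so the error can be
  halved by moving \<open>z\<close> by a distance of order \<open>e\<close>.  The Katetov condition for the pair \<open>a\<close>, \<open>z\<close>
  needs \<open>e \<le> f a\<close>; errors of at most half the minimum of \<open>f\<close> ensure this and keep \<open>z\<close> out of \<open>A\<close>.
  If \<open>f\<close> vanishes somewhere, a point of \<open>A\<close> is an exact realisation.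
\<close>

lemma nearly_generic_exact:
  assumes U: "polish_metric U" and F: "lip_family U K (mspace K) F" and near: "nearly_generic U K F"
    and A: "finite A" "A \<noteq> {}" "A \<subseteq> mspace U" and kat: "katetov U A f"
    and g: "profile K (mspace K) g"
    and Fg: "\<And>a k. a \<in> A \<Longrightarrow> k \<in> mspace K \<Longrightarrow> \<bar>F a k - g k\<bar> \<le> f a"
  shows "\<exists>z\<in>mspace U. (\<forall>a\<in>A. mdist U z a = f a) \<and> (\<forall>k\<in>mspace K. F z k = g k)"
proof (cases "\<exists>c\<in>A. f c = 0")
  case True
  then obtain c where c: "c \<in> A" "f c = 0" by blast
  have "mdist U c a = f a" if "a \<in> A" for a
    using katetovD(2)[OF kat c(1) that] katetovD(1)[OF kat that c(1)] c(2)
    by (simp add: mdist_commute)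
  moreover have "F c k = g k" if "k \<in> mspace K" for k using Fg[OF c(1) that] c(2) by simp
  ultimately show ?thesis using c A(3) by blast
next
  case False
  have katD: "f a \<le> f b + mdist U a b" "mdist U a b \<le> f a + f b" if "a \<in> A" "b \<in> A" for a b
    using katetovD[OF kat that] .
  define \<mu> where "\<mu> = Min (f ` A)"
  have \<mu>: "\<mu> \<le> f a" if "a \<in> A" for a unfolding \<mu>_def using A that by (intro Min_le) auto
  have "\<mu> \<in> f ` A" unfolding \<mu>_def using A by (intro Min_in) auto
  then have \<mu>0: "0 < \<mu>" using False katetov_nonneg[OF kat] by (auto simp: less_le)
  define ok where "ok e z \<longleftrightarrow> z \<in> mspace U \<and> (\<forall>a\<in>A. \<bar>mdist U z a - f a\<bar> \<le> e) \<and>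
    (\<forall>k\<in>mspace K. \<bar>F z k - g k\<bar> \<le> e)" for e z
  have step: "\<exists>z'. ok (e / 2) z' \<and> mdist U z z' \<le> 3 / 2 * e"
    if e: "0 < e" "e \<le> \<mu> / 2" and z: "ok e z" for e z
  proof -
    have zA: "z \<notin> A"
    proof
      assume "z \<in> A"
      then have "\<bar>mdist U z z - f z\<bar> \<le> e" "\<mu> \<le> f z" "mdist U z z = 0" using z \<mu> A by (auto simp: ok_def)
      then show False using e \<mu>0 by linarith
    qed
    have za: "\<bar>mdist U z a - f a\<bar> \<le> e" "e \<le> f a" if "a \<in> A" for a
      using z that \<mu>[OF that] e \<mu>0 by (auto simp: ok_def)
    have zU: "z \<in> mspace U" using z by (simp add: ok_def)
    have "f a \<le> e + mdist U a z" "e \<le> f a + mdist U z a" "mdist U a z \<le> f a + e"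
      "mdist U z a \<le> e + f a" if "a \<in> A" for a
      using za[OF that] mdist_nonneg[of U a z] mdist_commute[of U a z] by linarith+
    then have "katetov U (insert z A) (f(z := e))"
      unfolding katetov_def using katD zA e(1) zU by auto
    moreover have "\<bar>F a k - g k\<bar> \<le> (f(z := e)) a" if "a \<in> insert z A" "k \<in> mspace K" for a k
      using Fg z that by (auto simp: ok_def)
    ultimately have "\<exists>z'\<in>mspace U. (\<forall>a\<in>insert z A. \<bar>mdist U z' a - (f(z := e)) a\<bar> \<le> e / 2) \<and>
        (\<forall>k\<in>mspace K. \<bar>F z' k - g k\<bar> \<le> e / 2)"
      using near[unfolded nearly_generic_def, rule_format, of "insert z A" "f(z := e)" g "e / 2"]
        A zU g e by auto
    then obtain z' where z': "z' \<in> mspace U" "\<And>a. a \<in> insert z A \<Longrightarrow> \<bar>mdist U z' a - (f(z := e)) a\<bar> \<le> e / 2"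
      "\<And>k. k \<in> mspace K \<Longrightarrow> \<bar>F z' k - g k\<bar> \<le> e / 2" by blast
    have "\<bar>mdist U z' a - f a\<bar> \<le> e / 2" if "a \<in> A" for a
    proof -
      have "a \<noteq> z" using that zA by blast
      then show ?thesis using z'(2)[of a] that by simp
    qed
    moreover have "\<bar>mdist U z' z - e\<bar> \<le> e / 2" using z'(2)[of z] by simp
    then have "mdist U z z' \<le> 3 / 2 * e" unfolding mdist_commute[of U z z'] by linarith
    ultimately show ?thesis using z'(1,3) unfolding ok_def by blast
  qed
  define e where "e n = \<mu> / 2 * (1 / 2) ^ n" for n :: nat
  have e: "0 < e n" "e n \<le> \<mu> / 2" "e (Suc n) = e n / 2" for n
    using \<mu>0 by (auto simp: e_def power_le_one mult_left_le)
  have e_small: "\<exists>N. e N < x" if x: "0 < x" for x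
  proof -
    obtain N where "(1 / 2) ^ N < x / (\<mu> / 2)"
      using real_arch_pow_inv[of "x / (\<mu> / 2)" "1 / 2"] \<mu>0 x by auto
    then show ?thesis using \<mu>0 by (intro exI[of _ N]) (simp add: e_def field_simps)
  qed
  have e_mono: "e m \<le> e n" if "n \<le> m" for n m
  proof (rule lift_Suc_antimono_le[OF _ that])
    show "e (Suc n) \<le> e n" for n using e(1)[of n] e(3)[of n] by linarith
  qed
  have "\<exists>s. \<forall>n. ok (e n) (s n) \<and> mdist U (s n) (s (Suc n)) \<le> 3 / 2 * e n"
  proof (rule dependent_nat_choice)
    show "\<exists>z. ok (e 0) z"
      using near[unfolded nearly_generic_def, rule_format, of A f g "e 0"] A kat g Fg e(1)
      unfolding ok_def by auto
    show "\<exists>z'. ok (e (Suc n)) z' \<and> mdist U z z' \<le> 3 / 2 * e n" if "ok (e n) z" for z n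
      using step[OF e(1,2) that] by (simp add: e(3))
  qed
  then obtain s where s: "\<And>n. ok (e n) (s n)" "\<And>n. mdist U (s n) (s (Suc n)) \<le> 3 / 2 * e n" by blast
  have sU: "s n \<in> mspace U" for n using s(1) by (simp add: ok_def)
  \<comment> \<open>The steps \<open>3 / 2 * e n\<close> telescope, being equal to \<open>3 * (e n - e (Suc n))\<close>.\<close>
  have tele: "mdist U (s n) (s m) \<le> 3 * (e n - e m)" if "n \<le> m" for n m
    using that
  proof (induction m rule: dec_induct)
    case base
    then show ?case using sU by simp
  next
    case (step m)
    have "mdist U (s n) (s (Suc m)) \<le> mdist U (s n) (s m) + mdist U (s m) (s (Suc m))"
      using sU by (intro mdist_triangle)
    moreover have "3 * (e n - e m) + 3 / 2 * e m = 3 * (e n - e (Suc m))"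
      using e(3)[of m] by (simp add: field_simps)
    ultimately show ?case using step.IH s(2)[of m] by linarith
  qed
  have cauchy: "\<exists>N. \<forall>n\<ge>N. \<forall>n'\<ge>N. mdist U (s n) (s n') < x" if x: "0 < x" for x
  proof -
    obtain N where N: "e N < x / 6" using e_small[of "x / 6"] x by auto
    have "mdist U (s n) (s n') < x" if "N \<le> n" "N \<le> n'" for n n'
    proof -
      have "mdist U (s n) (s n') \<le> mdist U (s n) (s N) + mdist U (s N) (s n')"
        using sU by (intro mdist_triangle)
      then show ?thesis
        using tele[OF that(1)] tele[OF that(2)] N e(1)[of n] e(1)[of n']
        by (simp add: mdist_commute[of U "s n" "s N"])
    qed
    then show ?thesis by blast
  qed
  obtain z where z: "z \<in> mspace U" "\<And>x. 0 < x \<Longrightarrow> \<exists>N. \<forall>n\<ge>N. mdist U (s n) z < x"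
    by (rule polish_limit[OF U sU cauchy]) (assumption, rule that)
  have close: "\<exists>n. mdist U (s n) z < x \<and> e n < x" if x: "0 < x" for x
  proof -
    obtain N where N: "\<And>n. n \<ge> N \<Longrightarrow> mdist U (s n) z < x" using z(2)[OF x] by blast
    obtain N' where N': "e N' < x" using e_small[OF x] by blast
    have "e (max N N') < x" using e_mono[of N' "max N N'"] N' by linarith
    then show ?thesis using N[of "max N N'"] by auto
  qed
  show ?thesis
  proof (intro bexI[OF _ z(1)] conjI ballI)
    fix a assume a: "a \<in> A"
    have "\<bar>mdist U z a - f a\<bar> \<le> 0"
    proof (rule field_le_epsilon)
      fix x :: real assume "0 < x"
      then obtain n where n: "mdist U (s n) z < x / 2" "e n < x / 2" using close[of "x / 2"] by auto
      have "\<bar>mdist U (s n) a - mdist U z a\<bar> \<le> mdist U (s n) z + mdist U a a"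
        using sU z(1) a A(3) by (intro mdist_perturb) auto
      moreover have "\<bar>mdist U (s n) a - f a\<bar> \<le> e n" using s(1) a by (simp add: ok_def)
      moreover have "mdist U a a = 0" using a A(3) by auto
      ultimately show "\<bar>mdist U z a - f a\<bar> \<le> 0 + x" using n by linarith
    qed
    then show "mdist U z a = f a" by simp
  next
    fix k assume k: "k \<in> mspace K"
    have "\<bar>F z k - g k\<bar> \<le> 0"
    proof (rule field_le_epsilon)
      fix x :: real assume "0 < x"
      then obtain n where n: "mdist U (s n) z < x / 2" "e n < x / 2" using close[of "x / 2"] by auto
      have "\<bar>F (s n) k - F z k\<bar> \<le> mdist U (s n) z" by (rule lip_family_abs[OF F sU z(1) k])
      moreover have "\<bar>F (s n) k - g k\<bar> \<le> e n" using s(1) k by (simp add: ok_def)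
      ultimately show "\<bar>F z k - g k\<bar> \<le> 0 + x" using n by linarith
    qed
    then show "F z k = g k" by simp
  qed
qed

lemma generic_exists:
  assumes U: "urysohn_space U" and K: "compact_space (mtopology_of K)"
  obtains F where "generic U K (mspace K) F"
proof -
  have polish: "polish_metric U" using U by (simp add: urysohn_space_def)
  obtain F where lip: "lip_family U K (mspace K) F" and near: "nearly_generic U K F"
    by (rule nearly_generic_exists[OF U K]) (rule that)
  obtain u where u: "u \<in> mspace U"
    by (rule urysohn_one_point[OF U, of "{}" "\<lambda>_. 0"]) (auto simp: katetov_def)
  have "generic U K (mspace K) F"
    unfolding generic_def
  proof (intro conjI lip allI impI)
    fix A f g
    assume a: "finite A \<and> A \<subseteq> mspace U \<and> katetov U A f \<and> profile K (mspace K) g \<and>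
      (\<forall>a\<in>A. \<forall>k\<in>mspace K. \<bar>F a k - g k\<bar> \<le> f a)"
    show "\<exists>z\<in>mspace U. (\<forall>a\<in>A. mdist U z a = f a) \<and> (\<forall>k\<in>mspace K. F z k = g k)"
    proof (cases "A = {}")
      case False
      show ?thesis by (rule nearly_generic_exact[OF polish lip near]) (use a False in auto)
    next
      case True
      \<comment> \<open>Put the new point so far away from \<open>u\<close> that the profile of \<open>u\<close> imposes no condition.\<close>
      have "\<exists>c\<ge>0. \<forall>k\<in>mspace K. \<bar>F u k - g k\<bar> \<le> c"
      proof (cases "mspace K = {}")
        case False
        then obtain l where l: "l \<in> mspace K" by blast
        obtain B where B: "\<And>k l. k \<in> mspace K \<Longrightarrow> l \<in> mspace K \<Longrightarrow> mdist K k l \<le> B"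
          by (rule compact_bounded[OF K]) (rule that)
        have pF: "profile K (mspace K) (F u)" using lip u by (simp add: lip_family_def)
        have g: "profile K (mspace K) g" using a by blast
        have "\<bar>F u k - g k\<bar> \<le> F u l + g l + B" if k: "k \<in> mspace K" for k
        proof -
          have "F u k \<le> F u l + mdist K k l" "g k \<le> g l + mdist K k l" "0 \<le> F u k" "0 \<le> g k"
            "0 \<le> F u l" "0 \<le> g l"
            using profileD[OF pF k l] profileD[OF g k l] profile_nonneg[OF pF] profile_nonneg[OF g] k l
            by auto
          then show ?thesis using B[OF k l] by linarith
        qed
        then show ?thesis by (intro exI[of _ "\<bar>F u l + g l + B\<bar>"]) force
      qed auto
      then obtain c where c: "0 \<le> c" "\<And>k. k \<in> mspace K \<Longrightarrow> \<bar>F u k - g k\<bar> \<le> c" by blast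
      have "katetov U {u} (\<lambda>_. c)" using c(1) u by (simp add: katetov_def)
      then have "\<exists>z\<in>mspace U. (\<forall>a\<in>{u}. mdist U z a = c) \<and> (\<forall>k\<in>mspace K. F z k = g k)"
        by (intro nearly_generic_exact[OF polish lip near]) (use u c(2) a in auto)
      then show ?thesis using True by blast
    qed
  qed
  then show thesis by (rule that)
qed

section \<open>Closed sets and their distance functions\<close>

lemma minfdist_le: "c \<in> C \<Longrightarrow> minfdist m z C \<le> mdist m z c"
  unfolding minfdist_def by (auto intro!: cINF_lower bdd_belowI[of _ 0])

lemma minfdist_ge:
  assumes "C \<noteq> {}" "\<And>c. c \<in> C \<Longrightarrow> b \<le> mdist m z c"
  shows "b \<le> minfdist m z C"
  using assms unfolding minfdist_def by (auto intro!: cINF_greatest)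

lemma minfdist_nonneg: "0 \<le> minfdist m z C"
  by (cases "C = {}") (simp add: minfdist_def, rule minfdist_ge, simp_all)

lemma minfdist_lipschitz:
  assumes C: "C \<subseteq> mspace m" and z: "z \<in> mspace m" and w: "w \<in> mspace m"
  shows "minfdist m z C \<le> minfdist m w C + mdist m z w"
proof (cases "C = {}")
  case True
  then show ?thesis by (simp add: minfdist_def)
next
  case False
  have "minfdist m z C - mdist m z w \<le> minfdist m w C"
  proof (rule minfdist_ge[OF False])
    fix c assume c: "c \<in> C"
    have "mdist m z c \<le> mdist m z w + mdist m w c"
      using c C z w by (intro mdist_triangle) auto
    then show "minfdist m z C - mdist m z w \<le> mdist m w c"
      using minfdist_le[OF c, of m z] by linarith
  qed
  then show ?thesis by linarith
qed

lemma minfdist_closed_eq_0_iff: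
  assumes C: "closedin (mtopology_of m) C" "C \<noteq> {}" and z: "z \<in> mspace m"
  shows "minfdist m z C = 0 \<longleftrightarrow> z \<in> C"
proof
  interpret m: Metric_space "mspace m" "mdist m" by simp
  assume eq: "minfdist m z C = 0"
  show "z \<in> C"
  proof (rule ccontr)
    assume "z \<notin> C"
    then obtain r where r: "0 < r" "disjnt C (m.mball z r)"
      using C(1) z unfolding mtopology_of_def m.closedin_metric by blast
    have "C \<subseteq> mspace m" using closedin_subset[OF C(1)] by simp
    then have "r \<le> mdist m z c" if "c \<in> C" for c
      using r(2) that z unfolding disjnt_iff m.in_mball by force
    then show False using minfdist_ge[OF C(2), of r m z] r(1) eq by simp
  qed
next
  assume "z \<in> C"
  then have "minfdist m z C \<le> 0" using minfdist_le[of z C m z] z by simp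
  then show "minfdist m z C = 0" using minfdist_nonneg[of m z C] by simp
qed

definition set_dist :: "'u metric \<Rightarrow> 'k metric \<Rightarrow> ('u \<times> 'k) set \<Rightarrow> 'u \<Rightarrow> 'k \<Rightarrow> real" where
  "set_dist U K C x k = minfdist (sum_metric U K) (x, k) C"

lemma set_dist_lip_family:
  assumes "C \<subseteq> mspace U \<times> mspace K"
  shows "lip_family U K (mspace K) (set_dist U K C)"
  unfolding lip_family_def profile_def set_dist_def
proof (intro ballI conjI minfdist_nonneg)
  fix x k l assume "x \<in> mspace U" "k \<in> mspace K" "l \<in> mspace K"
  then show "minfdist (sum_metric U K) (x, k) C \<le> minfdist (sum_metric U K) (x, l) C + mdist K k l"
    using minfdist_lipschitz[of C "sum_metric U K" "(x, k)" "(x, l)"] assms by simp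
next
  fix x y k assume "x \<in> mspace U" "y \<in> mspace U" "k \<in> mspace K"
  then show "minfdist (sum_metric U K) (x, k) C \<le> minfdist (sum_metric U K) (y, k) C + mdist U x y"
    using minfdist_lipschitz[of C "sum_metric U K" "(x, k)" "(y, k)"] assms by simp
qed

lemma closedin_sum_metric_subset:
  "closedin (mtopology_of (sum_metric U K)) C \<Longrightarrow> C \<subseteq> mspace U \<times> mspace K"
  using closedin_subset[of "mtopology_of (sum_metric U K)" C] by simp

definition zero_set :: "'u metric \<Rightarrow> 'k metric \<Rightarrow> ('u \<Rightarrow> 'k \<Rightarrow> real) \<Rightarrow> ('u \<times> 'k) set" where
  "zero_set U K F = {(x, k). x \<in> mspace U \<and> k \<in> mspace K \<and> F x k = 0}"

lemma lip_family_sum_metric: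
  assumes F: "lip_family U K (mspace K) F" and "x \<in> mspace U" "y \<in> mspace U" "k \<in> mspace K" "l \<in> mspace K"
  shows "F x k \<le> F y l + mdist (sum_metric U K) (x, k) (y, l)"
  using lip_familyD[OF F assms(2,3,4)] profileD[OF lip_family_profile[OF F assms(3)] assms(4,5)]
  by simp

lemma closedin_zero_set:
  assumes F: "lip_family U K (mspace K) F"
  shows "closedin (mtopology_of (sum_metric U K)) (zero_set U K F)"
proof -
  let ?m = "sum_metric U K"
  interpret m: Metric_space "mspace ?m" "mdist ?m" by (rule Metric_space_mspace_mdist)
  have "\<exists>r>0. disjnt (zero_set U K F) (m.mball z r)" if z: "z \<in> mspace ?m - zero_set U K F" for z
  proof -
    obtain x k where xk: "z = (x, k)" "x \<in> mspace U" "k \<in> mspace K" "F x k \<noteq> 0"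
      using z by (cases z) (auto simp: zero_set_def)
    then have "0 < F x k"
      using profile_nonneg[OF lip_family_profile[OF F xk(2)] xk(3)] by simp
    moreover have "disjnt (zero_set U K F) (m.mball z (F x k))"
      unfolding disjnt_iff
    proof (intro allI notI, elim conjE)
      fix w assume w: "w \<in> zero_set U K F" and d: "w \<in> m.mball z (F x k)"
      obtain y l where yl: "w = (y, l)" "y \<in> mspace U" "l \<in> mspace K" "F y l = 0"
        using w by (auto simp: zero_set_def)
      have "mdist ?m (x, k) (y, l) < F x k" using d unfolding m.in_mball xk(1) yl(1) by simp
      then show False
        using lip_family_sum_metric[OF F xk(2) yl(2) xk(3) yl(3)] yl(4) by linarith
    qed
    ultimately show ?thesis by blast
  qed
  moreover have "zero_set U K F \<subseteq> mspace ?m" by (auto simp: zero_set_def)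
  ultimately show ?thesis unfolding mtopology_of_def m.closedin_metric by blast
qed

text \<open>
  A closest zero to \<open>(x, k)\<close> can be found over the same \<open>k\<close>: genericity provides a point at
  distance \<open>F x k\<close> from \<open>x\<close> whose profile is that of \<open>x\<close> lowered by \<open>F x k\<close> and truncated at
  zero.
\<close>

lemma set_dist_zero_set:
  assumes gen: "generic U K (mspace K) F" and x: "x \<in> mspace U" and k: "k \<in> mspace K"
  shows "set_dist U K (zero_set U K F) x k = F x k"
proof -
  note lip = generic_lip[OF gen]
  have prof: "profile K (mspace K) (F x)" using lip x by (rule lip_family_profile)
  have c: "0 \<le> F x k" using prof k by (rule profile_nonneg)
  have "katetov U {x} (\<lambda>_. F x k)" using c x by (simp add: katetov_def)
  moreover have "profile K (mspace K) (\<lambda>l. max (F x l - F x k) 0)"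
    unfolding profile_def
  proof (intro ballI conjI)
    fix l l' assume "l \<in> mspace K" "l' \<in> mspace K"
    then have "F x l \<le> F x l' + mdist K l l'" using profileD[OF prof] by blast
    then show "max (F x l - F x k) 0 \<le> max (F x l' - F x k) 0 + mdist K l l'"
      using mdist_nonneg[of K l l'] by linarith
  qed simp
  moreover have "\<bar>F a l - max (F x l - F x k) 0\<bar> \<le> F x k" if "a \<in> {x}" "l \<in> mspace K" for a l
    using profile_nonneg[OF prof that(2)] c that(1) by auto
  ultimately obtain z where z: "z \<in> mspace U" "mdist U z x = F x k"
    "\<And>l. l \<in> mspace K \<Longrightarrow> F z l = max (F x l - F x k) 0"
    using genericD[OF gen, of "{x}" "\<lambda>_. F x k" "\<lambda>l. max (F x l - F x k) 0"] x
    by (metis empty_subsetI finite.emptyI finite.insertI insertCI insert_subset)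
  have zk: "(z, k) \<in> zero_set U K F" using z k by (simp add: zero_set_def)
  show ?thesis
  proof (rule antisym)
    have "mdist (sum_metric U K) (x, k) (z, k) = F x k"
      using z(2) k by (simp add: mdist_commute)
    then show "set_dist U K (zero_set U K F) x k \<le> F x k"
      using minfdist_le[OF zk, of "sum_metric U K" "(x, k)"] by (simp add: set_dist_def)
    show "F x k \<le> set_dist U K (zero_set U K F) x k"
      unfolding set_dist_def
    proof (rule minfdist_ge)
      show "zero_set U K F \<noteq> {}" using zk by blast
      fix w assume "w \<in> zero_set U K F"
      then obtain y l where yl: "w = (y, l)" "y \<in> mspace U" "l \<in> mspace K" "F y l = 0"
        by (auto simp: zero_set_def)
      show "F x k \<le> mdist (sum_metric U K) (x, k) w"
        using lip_family_sum_metric[OF lip x yl(2) k yl(3)] yl(4) by (simp add: yl(1))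
    qed
  qed
qed

section \<open>Ultrahomogeneity, universality and uniqueness\<close>

lemma generic_cong:
  assumes eq: "\<And>x k. x \<in> mspace U \<Longrightarrow> k \<in> S \<Longrightarrow> F x k = G x k" and F: "generic U K S F"
  shows "generic U K S G"
  unfolding generic_def
proof (intro conjI allI impI)
  show "lip_family U K S G"
    using generic_lip[OF F] eq by (simp add: lip_family_def profile_def)
  fix A f g
  assume a: "finite A \<and> A \<subseteq> mspace U \<and> katetov U A f \<and> profile K S g \<and>
    (\<forall>a\<in>A. \<forall>k\<in>S. \<bar>G a k - g k\<bar> \<le> f a)"
  then have "\<bar>F a k - g k\<bar> \<le> f a" if "a \<in> A" "k \<in> S" for a k
    using eq[of a k] that by auto
  then obtain z where z: "z \<in> mspace U" "\<And>a. a \<in> A \<Longrightarrow> mdist U z a = f a"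
    "\<And>k. k \<in> S \<Longrightarrow> F z k = g k"
    using genericD[OF F, of A f g] a by metis
  show "\<exists>z\<in>mspace U. (\<forall>a\<in>A. mdist U z a = f a) \<and> (\<forall>k\<in>S. G z k = g k)"
    using z eq[OF z(1)] by (intro bexI[OF _ z(1)]) simp
qed

text \<open>Distances to the empty set are 0 by convention, whereas a generic family takes the value 1.\<close>

lemma generic_nonempty:
  assumes gen: "generic U K (mspace K) (set_dist U K C)" and K: "mspace K \<noteq> {}"
  shows "C \<noteq> {}"
proof
  assume "C = {}"
  moreover obtain k where k: "k \<in> mspace K" using K by blast
  moreover have "\<exists>z. set_dist U K C z k = 1"
    by (rule genericD[OF gen, of "{}" "\<lambda>_. 0" "\<lambda>_. 1"]) (use k in \<open>auto simp: katetov_def profile_def\<close>)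
  ultimately show False by (simp add: set_dist_def minfdist_def)
qed

lemma generic_imp_ultrahomogeneous:
  assumes U: "polish_metric U" and gen: "generic U K (mspace K) (set_dist U K C)"
  shows "ultrahomogeneous U K C"
  unfolding ultrahomogeneous_def set_dist_def[symmetric]
proof (intro allI impI, elim conjE)
  fix A B S i
  assume A: "finite A" "A \<subseteq> mspace U" and B: "B \<subseteq> mspace U" and S: "S \<subseteq> mspace K"
    and i: "isometry_onto U A B i"
    and same: "\<forall>x\<in>A. \<forall>k\<in>S. set_dist U K C x k = set_dist U K C (i x) k"
  let ?F = "set_dist U K C" and ?p = "(\<lambda>a. (a, i a)) ` A"
  have gS: "generic U K S ?F" using gen S by (rule generic_subset)
  have "finite ?p" using A(1) by simp
  moreover have "\<forall>s\<in>?p. \<forall>t\<in>?p. matching U U S ?F ?F s t"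
    using A(2) B i same unfolding isometry_onto_def matching_def by auto
  ultimately obtain \<phi> where \<phi>: "\<phi> ` mspace U = mspace U"
    "\<And>x x'. x \<in> mspace U \<Longrightarrow> x' \<in> mspace U \<Longrightarrow> mdist U (\<phi> x) (\<phi> x') = mdist U x x'"
    "\<And>x k. x \<in> mspace U \<Longrightarrow> k \<in> S \<Longrightarrow> ?F x k = ?F (\<phi> x) k"
    "\<And>x y. (x, y) \<in> ?p \<Longrightarrow> \<phi> x = y"
    by (rule generic_isometry[OF U U gS gS]) (rule that)
  have "autoisometry U \<phi>" using \<phi>(1,2) by (simp add: isometry_onto_def)
  moreover have "\<forall>x\<in>A. \<phi> x = i x" using \<phi>(4) by blast
  moreover have "\<forall>x\<in>mspace U. \<forall>k\<in>S. ?F x k = ?F (\<phi> x) k" using \<phi>(3) by blast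
  ultimately show "\<exists>\<phi>. autoisometry U \<phi> \<and> (\<forall>x\<in>A. \<phi> x = i x) \<and>
      (\<forall>x\<in>mspace U. \<forall>k\<in>S. ?F x k = ?F (\<phi> x) k)"
    by (intro exI[of _ \<phi>] conjI)
qed

lemma generic_imp_universal:
  assumes U: "polish_metric U" and gen: "generic U K (mspace K) (set_dist U K C)"
  shows "universal U K C"
  unfolding universal_def set_dist_def[symmetric]
proof (intro allI impI, elim conjE)
  fix X :: "real metric" and E
  assume X: "polish_metric X" and E: "closedin (mtopology_of (sum_metric X K)) E"
  have "lip_family X K (mspace K) (set_dist X K E)"
    using E by (intro set_dist_lip_family closedin_sum_metric_subset)
  then obtain \<phi> where "isometric_embedding X U \<phi>"
    "\<And>x k. x \<in> mspace X \<Longrightarrow> k \<in> mspace K \<Longrightarrow> set_dist X K E x k = set_dist U K C (\<phi> x) k"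
    by (rule generic_embedding[OF X U _ gen]) (rule that)
  then show "\<exists>\<iota>. isometric_embedding X U \<iota> \<and>
      (\<forall>x\<in>mspace X. \<forall>k\<in>mspace K. set_dist X K E x k = set_dist U K C (\<iota> x) k)"
    by (intro exI[of _ \<phi>]) simp
qed

text \<open>
  Uniqueness reduces to genericity.  An extension of \<open>A\<close> is realised over a copy of \<open>A\<close> in the
  generic \<open>(U, C)\<close>, which by universality embeds into \<open>(U, C')\<close>; by ultrahomogeneity the
  resulting isometry from \<open>A\<close> to the image of its copy extends to an automorphism of
  \<open>(U, C')\<close>, whose inverse moves the image of the new point to the required place.
\<close>

lemma universal_ultrahomogeneous_imp_generic:
  assumes U: "polish_metric U" and gen: "generic U K (mspace K) (set_dist U K C)"
    and C: "closedin (mtopology_of (sum_metric U K)) C"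
    and C': "closedin (mtopology_of (sum_metric U K)) C'"
    and hom: "ultrahomogeneous U K C'" and univ: "universal U K C'"
  shows "generic U K (mspace K) (set_dist U K C')"
proof -
  let ?F = "set_dist U K C" and ?F' = "set_dist U K C'"
  have lip': "lip_family U K (mspace K) ?F'"
    using C' by (intro set_dist_lip_family closedin_sum_metric_subset)
  have "\<exists>j. isometric_embedding U U j \<and> (\<forall>x\<in>mspace U. \<forall>k\<in>mspace K. ?F x k = ?F' (j x) k)"
    unfolding set_dist_def by (rule universalD[OF univ U C])
  then obtain j where j: "isometric_embedding U U j"
    and jF: "\<And>x k. x \<in> mspace U \<Longrightarrow> k \<in> mspace K \<Longrightarrow> ?F x k = ?F' (j x) k"
    by (elim exE conjE) simp
  have jU: "j x \<in> mspace U" if "x \<in> mspace U" for x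
    using j that unfolding isometric_embedding_def by blast
  have jd: "mdist U (j x) (j y) = mdist U x y" if "x \<in> mspace U" "y \<in> mspace U" for x y
    using j that unfolding isometric_embedding_def by blast
  obtain e where e: "isometric_embedding U U e"
    and eF: "\<And>x k. x \<in> mspace U \<Longrightarrow> k \<in> mspace K \<Longrightarrow> ?F' x k = ?F (e x) k"
    by (rule generic_embedding[OF U U lip' gen]) (rule that)
  have eU: "e x \<in> mspace U" if "x \<in> mspace U" for x
    using e that unfolding isometric_embedding_def by blast
  have ed: "mdist U (e x) (e y) = mdist U x y" if "x \<in> mspace U" "y \<in> mspace U" for x y
    using e that unfolding isometric_embedding_def by blast
  have e_inj: "inj_on e (mspace U)"
  proof (rule inj_onI)
    fix x y assume "x \<in> mspace U" "y \<in> mspace U" "e x = e y"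
    then show "x = y" using ed[of x y] eU[of y] by simp
  qed
  show ?thesis
    unfolding generic_def
  proof (intro conjI lip' allI impI)
    fix A f g
    assume a: "finite A \<and> A \<subseteq> mspace U \<and> katetov U A f \<and> profile K (mspace K) g \<and>
      (\<forall>a\<in>A. \<forall>k\<in>mspace K. \<bar>?F' a k - g k\<bar> \<le> f a)"
    then have A: "finite A" "A \<subseteq> mspace U" by simp_all
    have injA: "inj_on e A" using e_inj A(2) by (rule inj_on_subset)
    define i where "i = inv_into A e"
    have ie: "i (e x) = x" if "x \<in> A" for x
      unfolding i_def using injA that by simp
    have kat: "katetov U (e ` A) (f \<circ> i)"
      unfolding katetov_def
    proof (intro ballI)
      fix b b' assume "b \<in> e ` A" "b' \<in> e ` A"
      then obtain x y where "x \<in> A" "y \<in> A" "b = e x" "b' = e y" by blast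
      moreover have "f x \<le> f y + mdist U x y" "mdist U x y \<le> f x + f y"
        using katetovD[of U A f x y] a \<open>x \<in> A\<close> \<open>y \<in> A\<close> by simp_all
      ultimately show "(f \<circ> i) b \<le> (f \<circ> i) b' + mdist U b b' \<and> mdist U b b' \<le> (f \<circ> i) b + (f \<circ> i) b'"
        using ed[of x y] A(2) by (simp add: ie subset_iff)
    qed
    have compat: "\<bar>?F b k - g k\<bar> \<le> (f \<circ> i) b" if b: "b \<in> e ` A" and k: "k \<in> mspace K" for b k
    proof -
      obtain x where x: "x \<in> A" "b = e x" using b by blast
      then have "?F b k = ?F' x k" using eF[of x k] A(2) k by auto
      then show ?thesis using a x k by (simp add: ie)
    qed
    have eA: "finite (e ` A)" "e ` A \<subseteq> mspace U" and g: "profile K (mspace K) g"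
      using A eU a by auto
    obtain w where w: "w \<in> mspace U" "\<And>b. b \<in> e ` A \<Longrightarrow> mdist U w b = (f \<circ> i) b"
      "\<And>k. k \<in> mspace K \<Longrightarrow> ?F w k = g k"
      by (rule genericD[OF gen eA kat g compat]) (assumption, assumption, rule that)
    have "isometry_onto U A ((j \<circ> e) ` A) (j \<circ> e)"
      unfolding isometry_onto_def using A(2) eU by (auto simp: jd ed subset_iff)
    moreover have "?F' x k = ?F' ((j \<circ> e) x) k" if "x \<in> A" "k \<in> mspace K" for x k
      using eF[of x k] jF[of "e x" k] eU[of x] that A(2) by auto
    moreover have "finite ((j \<circ> e) ` A)" "(j \<circ> e) ` A \<subseteq> mspace U" using A eU jU by auto
    ultimately have "\<exists>\<phi>. autoisometry U \<phi> \<and> (\<forall>x\<in>A. \<phi> x = (j \<circ> e) x) \<and>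
        (\<forall>x\<in>mspace U. \<forall>k\<in>mspace K. ?F' x k = ?F' (\<phi> x) k)"
      using A by (intro hom[unfolded ultrahomogeneous_def set_dist_def[symmetric], rule_format,
          of A "(j \<circ> e) ` A" "mspace K" "j \<circ> e"] conjI ballI disjI2) simp_all
    then obtain \<phi> where \<phi>: "autoisometry U \<phi>" "\<And>x. x \<in> A \<Longrightarrow> \<phi> x = j (e x)"
      and \<phi>F: "\<And>x k. x \<in> mspace U \<Longrightarrow> k \<in> mspace K \<Longrightarrow> ?F' x k = ?F' (\<phi> x) k" by auto
    have "j w \<in> \<phi> ` mspace U" using \<phi>(1) jU[OF w(1)] by (simp add: isometry_onto_def)
    then obtain z where z: "z \<in> mspace U" "\<phi> z = j w" by auto
    have "mdist U z x = f x" if x: "x \<in> A" for x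
    proof -
      have xU: "x \<in> mspace U" using x A(2) by blast
      then have "mdist U z x = mdist U (\<phi> z) (\<phi> x)"
        using \<phi>(1) z(1) unfolding isometry_onto_def by simp
      also have "\<dots> = mdist U w (e x)" using jd[OF w(1) eU[OF xU]] z(2) \<phi>(2)[OF x] by simp
      also have "\<dots> = f x" using w(2)[of "e x"] x ie[OF x] by simp
      finally show ?thesis .
    qed
    moreover have "?F' z k = g k" if "k \<in> mspace K" for k
      using \<phi>F[OF z(1) that] jF[OF w(1) that] w(3)[OF that] z(2) by simp
    ultimately show "\<exists>z\<in>mspace U. (\<forall>a\<in>A. mdist U z a = f a) \<and> (\<forall>k\<in>mspace K. ?F' z k = g k)"
      using z(1) by blast
  qed
qed

theorem theorem2p14:
  fixes U :: "'u metric" and K :: "'k metric"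
  assumes "urysohn_space U" and "compact_space (mtopology_of K)"
  shows "\<exists>C. closedin (mtopology_of (sum_metric U K)) C \<and>
             ultrahomogeneous U K C \<and> universal U K C \<and>
             (\<forall>C'. closedin (mtopology_of (sum_metric U K)) C' \<and>
                    ultrahomogeneous U K C' \<and> universal U K C' \<longrightarrow>
                (\<exists>\<phi>. autoisometry U \<phi> \<and> map_prod \<phi> id ` C = C'))"
proof -
  have U: "polish_metric U" using assms(1) by (simp add: urysohn_space_def)
  obtain F where F: "generic U K (mspace K) F"
    by (rule generic_exists[OF assms]) (rule that)
  define C where "C = zero_set U K F"
  have C: "closedin (mtopology_of (sum_metric U K)) C"
    unfolding C_def by (rule closedin_zero_set[OF generic_lip[OF F]])
  have gen: "generic U K (mspace K) (set_dist U K C)"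
    unfolding C_def by (rule generic_cong[OF _ F]) (simp add: set_dist_zero_set[OF F])
  have unique: "\<exists>\<phi>. autoisometry U \<phi> \<and> map_prod \<phi> id ` C = C'"
    if C': "closedin (mtopology_of (sum_metric U K)) C'" "ultrahomogeneous U K C'" "universal U K C'"
    for C'
  proof -
    have gen': "generic U K (mspace K) (set_dist U K C')"
      by (rule universal_ultrahomogeneous_imp_generic[OF U gen C C'])
    obtain \<phi> where \<phi>: "\<phi> ` mspace U = mspace U"
      "\<And>x x'. x \<in> mspace U \<Longrightarrow> x' \<in> mspace U \<Longrightarrow> mdist U (\<phi> x) (\<phi> x') = mdist U x x'"
      "\<And>x k. x \<in> mspace U \<Longrightarrow> k \<in> mspace K \<Longrightarrow> set_dist U K C x k = set_dist U K C' (\<phi> x) k"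
      by (rule generic_isometry[OF U U gen gen', of "{}"]) (simp_all add: that)
    have sub: "C \<subseteq> mspace U \<times> mspace K" "C' \<subseteq> mspace U \<times> mspace K"
      using C C'(1) by (simp_all add: closedin_sum_metric_subset)
    have mem: "(x, k) \<in> C \<longleftrightarrow> (\<phi> x, k) \<in> C'" if "x \<in> mspace U" "k \<in> mspace K" for x k
    proof -
      have "\<phi> x \<in> mspace U" using \<phi>(1) that(1) by blast
      \<comment> \<open>Only for a nonempty closed set are its points those at distance 0.\<close>
      moreover have "C \<noteq> {}" "C' \<noteq> {}"
        using generic_nonempty[OF gen] generic_nonempty[OF gen'] that(2) by auto
      ultimately show ?thesis
        using minfdist_closed_eq_0_iff[OF C, of "(x, k)"] minfdist_closed_eq_0_iff[OF C'(1), of "(\<phi> x, k)"]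
          \<phi>(3)[OF that] that by (simp add: set_dist_def)
    qed
    have "map_prod \<phi> id ` C = C'"
    proof (intro equalityI subsetI)
      fix p assume "p \<in> map_prod \<phi> id ` C"
      then obtain x k where xk: "(x, k) \<in> C" "p = (\<phi> x, k)" by auto
      then show "p \<in> C'" using mem[of x k] sub(1) by auto
    next
      fix p assume p: "p \<in> C'"
      obtain y k where yk: "p = (y, k)" by (cases p)
      then have "y \<in> \<phi> ` mspace U" "k \<in> mspace K" using p sub(2) \<phi>(1) by auto
      then obtain x where x: "x \<in> mspace U" "y = \<phi> x" by blast
      then have "(x, k) \<in> C" using mem[of x k] p yk \<open>k \<in> mspace K\<close> by simp
      then have "map_prod \<phi> id (x, k) \<in> map_prod \<phi> id ` C" by (rule imageI)
      then show "p \<in> map_prod \<phi> id ` C" by (simp add: yk x(2))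
    qed
    moreover have "autoisometry U \<phi>" using \<phi>(1,2) by (simp add: isometry_onto_def)
    ultimately show ?thesis by (intro exI[of _ \<phi>] conjI)
  qed
  show ?thesis
    by (intro exI[of _ C] conjI allI impI C generic_imp_ultrahomogeneous[OF U gen]
      generic_imp_universal[OF U gen]) (elim conjE, rule unique)
qed

end
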